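(* In the setting below (with $M\ge2$ fixed), there exists a function $g$ defined for small $\delta>0$ such that $L(D_{\mathcal N,0}+\delta)\le g(\delta)$ for all sufficiently small $\delta>0$, and $$\lim_{\delta\downarrow0}\frac{g(\delta)}{\frac M2\log\frac1\delta}=1.$$
   Context: Let $X$ be a real random variable with a density, finite variance $\sigma_X^2>0$ and finite differential entropy (natural logs throughout). Fix an integer $M\ge2$ and $\sigma_W^2>0$; let $W_1,\dots,W_M$ be i.i.d. $\mathcal N(0,\sigma_W^2)$ independent of $X$, $Y_i=X+W_i$, and $D_{\mathcal N,0}=\frac{\sigma_X^2\sigma_W^2}{M\sigma_X^2+\sigma_W^2}$. Consider $n$ i.i.d. copies. $R_X^{\mathrm{CEO}}(D)$ is the infimum of sum-rates $R_1+\dots+R_M$ for which, for every $\varepsilon>0$ and all large $n$, there exist encoders $i$ mapping $Y_i^n$ to indices in $\{1,\dots,\lfloor e^{nR_i}\rfloor\}$ and a joint decoder outputting $\hat X^n$ with $\frac1n\sum_t\mathbb E[(X_t-\hat X_t)^2]\le D+\varepsilon$; $R_X^{\mathrm R}(D)$ is the analogous quantity with a single encoder observing all $(Y_1^n,\dots,Y_M^n)$ at rate $R$. The rate loss is $L(D)=R_X^{\mathrm{CEO}}(D)-R_X^{\mathrm R}(D)$. *)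

theory Defs
  imports "HOL-Probability.Probability"
begin

text \<open>Gaussian CEO problem, operational definitions.  The source X is given by its
  density p w.r.t. Lebesgue measure; noise variance s2 (= sigma_W^2); M agents.\<close>

definition var_X :: "(real \<Rightarrow> real) \<Rightarrow> real" where
  "var_X p = (\<integral>x. x\<^sup>2 * p x \<partial>lborel) - (\<integral>x. x * p x \<partial>lborel)\<^sup>2"

definition src_meas :: "(real \<Rightarrow> real) \<Rightarrow> real \<Rightarrow> nat \<Rightarrow> (real \<times> (nat \<Rightarrow> real)) measure" where
  "src_meas p s2 M =
     density lborel p \<Otimes>\<^sub>M (\<Pi>\<^sub>M i\<in>{..<M}. density lborel (normal_density 0 (sqrt s2)))"

definition block_meas :: "(real \<Rightarrow> real) \<Rightarrow> real \<Rightarrow> nat \<Rightarrow> nat \<Rightarrow> (nat \<Rightarrow> real \<times> (nat \<Rightarrow> real)) measure" where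
  "block_meas p s2 M n = (\<Pi>\<^sub>M t\<in>{..<n}. src_meas p s2 M)"

definition obs :: "nat \<Rightarrow> (nat \<Rightarrow> real \<times> (nat \<Rightarrow> real)) \<Rightarrow> nat \<Rightarrow> (nat \<Rightarrow> real)" where
  "obs n \<omega> i = (\<lambda>t\<in>{..<n}. fst (\<omega> t) + snd (\<omega> t) i)"

definition srcX :: "nat \<Rightarrow> (nat \<Rightarrow> real \<times> (nat \<Rightarrow> real)) \<Rightarrow> nat \<Rightarrow> real" where
  "srcX n \<omega> = (\<lambda>t\<in>{..<n}. fst (\<omega> t))"

definition n_idx :: "nat \<Rightarrow> real \<Rightarrow> nat" where
  "n_idx n R = nat \<lfloor>exp (real n * R)\<rfloor>"

definition avg_dist ::
  "(real \<Rightarrow> real) \<Rightarrow> real \<Rightarrow> nat \<Rightarrow> nat \<Rightarrow> ((nat \<Rightarrow> real \<times> (nat \<Rightarrow> real)) \<Rightarrow> nat \<Rightarrow> real) \<Rightarrow> ennreal" where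
  "avg_dist p s2 M n xhat =
     ennreal (1 / real n) *
     (\<Sum>t<n. \<integral>\<^sup>+ \<omega>. ennreal ((srcX n \<omega> t - xhat \<omega> t)\<^sup>2) \<partial>block_meas p s2 M n)"

definition ceo_achievable :: "(real \<Rightarrow> real) \<Rightarrow> real \<Rightarrow> nat \<Rightarrow> real \<Rightarrow> (nat \<Rightarrow> real) \<Rightarrow> bool" where
  "ceo_achievable p s2 M D R \<longleftrightarrow>
     (\<forall>\<epsilon>>0. \<exists>N. \<forall>n\<ge>N. \<exists>(f :: nat \<Rightarrow> (nat \<Rightarrow> real) \<Rightarrow> nat) (\<phi> :: (nat \<Rightarrow> nat) \<Rightarrow> nat \<Rightarrow> real).
        (\<forall>i<M. f i \<in> measurable (\<Pi>\<^sub>M t\<in>{..<n}. borel) (count_space UNIV) \<and>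
               (\<forall>y\<in>space (\<Pi>\<^sub>M t\<in>{..<n}. (borel :: real measure)). f i y \<in> {1..n_idx n (R i)})) \<and>
        avg_dist p s2 M n (\<lambda>\<omega>. \<phi> (\<lambda>i\<in>{..<M}. f i (obs n \<omega> i))) \<le> ennreal (D + \<epsilon>))"

definition central_achievable :: "(real \<Rightarrow> real) \<Rightarrow> real \<Rightarrow> nat \<Rightarrow> real \<Rightarrow> real \<Rightarrow> bool" where
  "central_achievable p s2 M D R \<longleftrightarrow>
     (\<forall>\<epsilon>>0. \<exists>N. \<forall>n\<ge>N. \<exists>(f :: (nat \<Rightarrow> nat \<Rightarrow> real) \<Rightarrow> nat) (\<phi> :: nat \<Rightarrow> nat \<Rightarrow> real).
        f \<in> measurable (\<Pi>\<^sub>M i\<in>{..<M}. \<Pi>\<^sub>M t\<in>{..<n}. borel) (count_space UNIV) \<and>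
        (\<forall>y\<in>space (\<Pi>\<^sub>M i\<in>{..<M}. \<Pi>\<^sub>M t\<in>{..<n}. (borel :: real measure)). f y \<in> {1..n_idx n R}) \<and>
        avg_dist p s2 M n (\<lambda>\<omega>. \<phi> (f (\<lambda>i\<in>{..<M}. obs n \<omega> i))) \<le> ennreal (D + \<epsilon>))"

definition R_CEO :: "(real \<Rightarrow> real) \<Rightarrow> real \<Rightarrow> nat \<Rightarrow> real \<Rightarrow> real" where
  "R_CEO p s2 M D = Inf {(\<Sum>i<M. R i) | R. ceo_achievable p s2 M D R}"

definition R_R :: "(real \<Rightarrow> real) \<Rightarrow> real \<Rightarrow> nat \<Rightarrow> real \<Rightarrow> real" where
  "R_R p s2 M D = Inf {R. central_achievable p s2 M D R}"

definition rate_loss :: "(real \<Rightarrow> real) \<Rightarrow> real \<Rightarrow> nat \<Rightarrow> real \<Rightarrow> real" where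
  "rate_loss p s2 M D = R_CEO p s2 M D - R_R p s2 M D"

definition D_N0 :: "real \<Rightarrow> real \<Rightarrow> nat \<Rightarrow> real" where
  "D_N0 sX2 sW2 M = sX2 * sW2 / (real M * sX2 + sW2)"

end

theory Submission
  imports Defs "HOL-Real_Asymp.Real_Asymp"
begin

text \<open>
  Since \<open>R_R \<ge> 0\<close>, it suffices to bound the CEO sum-rate by \<open>M/2 log (1/\<delta>) + O(1)\<close>.
  Every agent quantises each sample with a uniform quantiser of step \<open>\<Delta> \<sim> sqrt \<delta>\<close> and dither \<open>u\<close>,
  and the decoder applies the linear MMSE estimator, whose unquantised distortion is \<open>D_N0\<close>.
  The second-order part of the quantisation error costs at most \<open>(c M \<Delta> / 2)\<^sup>2 = \<delta>\<close>; the first-order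
  cross term averages to zero over \<open>u\<close>, so for some fixed \<open>u\<close> it does not hurt.
  A block of quantiser outputs is an integer vector, typically of \<open>\<ell>\<^sub>1\<close>-norm at most \<open>n B\<close> with
  \<open>B = O(1/\<Delta>)\<close>, and there are at most \<open>(e (1 + 2 B))^n\<close> of those, i.e. the rate per agent is
  \<open>log (1/\<Delta>) + O(1)\<close>. Atypical blocks are sent as the zero vector; by Chebyshev's inequality
  and uniform integrability their contribution to the distortion vanishes as \<open>n\<close> grows.
\<close>

section \<open>Moments on product spaces\<close>

lemma has_bochner_integral_PiM_component:
  fixes f :: "'a \<Rightarrow> real"
  assumes "prob_space N" "i \<in> I" and f: "integrable N f"
  shows "has_bochner_integral (Pi\<^sub>M I (\<lambda>_. N)) (\<lambda>\<omega>. f (\<omega> i)) (\<integral>x. f x \<partial>N)"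
proof -
  have d: "distr (Pi\<^sub>M I (\<lambda>_. N)) N (\<lambda>\<omega>. \<omega> i) = N"
    using distr_PiM_component[of I "\<lambda>_. N" i] assms by simp
  have m: "(\<lambda>\<omega>. \<omega> i) \<in> measurable (Pi\<^sub>M I (\<lambda>_. N)) N"
    using assms by simp
  show ?thesis
    using integrable_distr[OF m, of f] integral_distr[OF m, of f] f
    by (simp add: d has_bochner_integral_iff)
qed

lemma nn_integral_PiM_component:
  assumes "prob_space N" "i \<in> I" and f: "f \<in> borel_measurable N"
  shows "(\<integral>\<^sup>+\<omega>. f (\<omega> i) \<partial>Pi\<^sub>M I (\<lambda>_. N)) = (\<integral>\<^sup>+x. f x \<partial>N)"
proof -
  have d: "distr (Pi\<^sub>M I (\<lambda>_. N)) N (\<lambda>\<omega>. \<omega> i) = N"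
    using distr_PiM_component[of I "\<lambda>_. N" i] assms by simp
  have m: "(\<lambda>\<omega>. \<omega> i) \<in> measurable (Pi\<^sub>M I (\<lambda>_. N)) N"
    using assms by simp
  have "(\<integral>\<^sup>+x. f x \<partial>N) = (\<integral>\<^sup>+x. f x \<partial>distr (Pi\<^sub>M I (\<lambda>_. N)) N (\<lambda>\<omega>. \<omega> i))"
    by (simp only: d)
  also have "\<dots> = (\<integral>\<^sup>+\<omega>. f (\<omega> i) \<partial>Pi\<^sub>M I (\<lambda>_. N))"
    using m f by (subst nn_integral_distr) auto
  finally show ?thesis by simp
qed

text \<open>Independence and centring remove the off-diagonal terms of the expanded square. This
  serves both Chebyshev's inequality on blocks and the variance of the summed noise.\<close>

lemma has_bochner_integral_PiM_sum_square:
  fixes f :: "'a \<Rightarrow> real"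
  assumes N: "prob_space N" and fin: "finite I"
    and f: "integrable N f" and f2: "integrable N (\<lambda>x. (f x)\<^sup>2)"
    and mean: "(\<integral>x. f x \<partial>N) = 0"
  shows "has_bochner_integral (Pi\<^sub>M I (\<lambda>_. N)) (\<lambda>\<omega>. (\<Sum>i\<in>I. f (\<omega> i))\<^sup>2)
           (real (card I) * (\<integral>x. (f x)\<^sup>2 \<partial>N))"
proof -
  interpret N: prob_space N by fact
  interpret P: product_sigma_finite "\<lambda>_. N" by standard
  have off: "has_bochner_integral (Pi\<^sub>M I (\<lambda>_. N)) (\<lambda>\<omega>. f (\<omega> i) * f (\<omega> j))
      (if i = j then \<integral>x. (f x)\<^sup>2 \<partial>N else 0)" if ij: "i \<in> I" "j \<in> I" for i j
  proof (cases "i = j")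
    case True
    then show ?thesis
      using has_bochner_integral_PiM_component[OF N ij(1) f2] by (simp add: power2_eq_square)
  next
    case False
    \<comment> \<open>Padding with the constant 1 turns the two-factor product into a product over
      all of \<open>I\<close>, to which the product form of Fubini applies.\<close>
    define g where "g k = (if k = i \<or> k = j then f else (\<lambda>_. 1))" for k
    have g: "integrable N (g k)" for k using f by (simp add: g_def)
    have eq: "(\<Prod>k\<in>I. g k (\<omega> k)) = f (\<omega> i) * f (\<omega> j)" for \<omega>
    proof -
      have "(\<Prod>k\<in>I. g k (\<omega> k)) = (\<Prod>k\<in>{i, j}. g k (\<omega> k))"
        by (rule prod.mono_neutral_right) (use fin ij in \<open>auto simp: g_def\<close>)
      then show ?thesis using False by (simp add: g_def)
    qed
    have "(\<Prod>k\<in>I. \<integral>x. g k x \<partial>N) = 0"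
      using ij fin mean by (intro prod_zero) (auto simp: g_def intro!: bexI[of _ i])
    then show ?thesis
      using P.product_integral_prod[of I g, OF fin g] P.product_integrable_prod[of I g, OF fin g] False
      by (simp add: eq has_bochner_integral_iff)
  qed
  have "has_bochner_integral (Pi\<^sub>M I (\<lambda>_. N)) (\<lambda>\<omega>. \<Sum>i\<in>I. \<Sum>j\<in>I. f (\<omega> i) * f (\<omega> j))
     (\<Sum>i\<in>I. \<Sum>j\<in>I. if i = j then \<integral>x. (f x)\<^sup>2 \<partial>N else 0)"
    by (intro has_bochner_integral_sum off)
  then show ?thesis
    using fin by (simp add: power2_eq_square sum_product)
qed

lemma has_bochner_integral_pair_mult:
  fixes f :: "'a \<Rightarrow> real" and g :: "'b \<Rightarrow> real"
  assumes "prob_space A" "prob_space B" and f: "integrable A f" and g: "integrable B g"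
  shows "has_bochner_integral (A \<Otimes>\<^sub>M B) (\<lambda>z. f (fst z) * g (snd z))
           ((\<integral>x. f x \<partial>A) * (\<integral>y. g y \<partial>B))"
proof -
  interpret A: prob_space A by fact
  interpret B: prob_space B by fact
  interpret AB: pair_sigma_finite A B ..
  have [measurable]: "f \<in> borel_measurable A" "g \<in> borel_measurable B" using f g by auto
  have i: "integrable (A \<Otimes>\<^sub>M B) (\<lambda>z. f (fst z) * g (snd z))"
    by (rule AB.Fubini_integrable) (use f g in \<open>auto simp: abs_mult\<close>)
  have "(\<integral>x. \<integral>y. f x * g y \<partial>B \<partial>A) = (\<integral>z. f (fst z) * g (snd z) \<partial>(A \<Otimes>\<^sub>M B))"
    using AB.integral_fst'[OF i] by simp
  then show ?thesis using i by (simp add: has_bochner_integral_iff)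
qed

section \<open>Uniform integrability and the cost of atypical blocks\<close>

lemma truncated_tail_tendsto_0:
  fixes h :: "'a \<Rightarrow> real"
  assumes h: "integrable N h" and pos: "\<And>x. h x \<ge> 0" and "\<epsilon> > 0"
  obtains K where "K \<ge> 0" "(\<integral>x. max 0 (h x - K) \<partial>N) \<le> \<epsilon>"
proof -
  have [measurable]: "h \<in> borel_measurable N" using h by auto
  have "(\<lambda>k. \<integral>x. max 0 (h x - real k) \<partial>N) \<longlonglongrightarrow> (\<integral>x. 0 \<partial>N)"
  proof (rule integral_dominated_convergence[where w = h])
    show "AE x in N. (\<lambda>k. max 0 (h x - real k)) \<longlonglongrightarrow> 0"
    proof (rule AE_I2)
      fix x
      have "eventually (\<lambda>k. max 0 (h x - real k) = 0) sequentially"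
        using eventually_ge_at_top[of "nat \<lceil>h x\<rceil>"] by eventually_elim linarith
      then show "(\<lambda>k. max 0 (h x - real k)) \<longlonglongrightarrow> 0" by (rule tendsto_eventually)
    qed
    show "AE x in N. norm (max 0 (h x - real k)) \<le> h x" for k
      using pos by (intro AE_I2) (auto simp: max_def)
  qed (use h in auto)
  then have "eventually (\<lambda>k. (\<integral>x. max 0 (h x - real k) \<partial>N) < \<epsilon>) sequentially"
    using \<open>\<epsilon> > 0\<close> by (intro order_tendstoD) auto
  then obtain k where "(\<integral>x. max 0 (h x - real k) \<partial>N) < \<epsilon>"
    by (auto simp: eventually_sequentially)
  then show ?thesis by (intro that[of "real k"]) auto
qed

text \<open>Truncating \<open>h\<close> at a level \<open>K\<close> splits the integral: the excess
  over \<open>K\<close> has small mean whatever the event is, and the bounded part costs at most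
  \<open>K\<close> times the probability of the event, which is O(1/n) by Chebyshev's inequality.
  The threshold \<open>n0\<close> is the same for all positions \<open>t\<close>.\<close>

lemma sum_exceedance_vanishes:
  fixes f h :: "'a \<Rightarrow> real"
  assumes N: "prob_space N"
    and f[measurable]: "f \<in> borel_measurable N" and f2: "integrable N (\<lambda>x. (f x)\<^sup>2)"
    and h: "integrable N h" and h_pos: "\<And>x. h x \<ge> 0"
    and B: "B \<ge> (\<integral>x. f x \<partial>N) + 1" and "\<epsilon> > 0"
  shows "\<exists>n0. \<forall>n\<ge>n0. \<forall>t<n.
    (\<integral>\<^sup>+\<omega>. ennreal (h (\<omega> t)) * indicator {\<omega>. (\<Sum>t<n. f (\<omega> t)) > real n * B} \<omega>
       \<partial>Pi\<^sub>M {..<n} (\<lambda>_. N)) \<le> ennreal \<epsilon>"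
proof -
  interpret N: prob_space N by fact
  have [measurable]: "h \<in> borel_measurable N" using h by auto
  have fi: "integrable N f" using N.square_integrable_imp_integrable[OF f f2] .
  define \<mu> where "\<mu> = (\<integral>x. f x \<partial>N)"
  define f0 where "f0 x = f x - \<mu>" for x
  have f0m[measurable]: "f0 \<in> borel_measurable N" unfolding f0_def by simp
  have f0i: "integrable N f0" unfolding f0_def using fi by simp
  have f02: "integrable N (\<lambda>x. (f0 x)\<^sup>2)"
    unfolding f0_def power2_diff using fi f2 by (auto simp: mult.assoc)
  have f0mean: "(\<integral>x. f0 x \<partial>N) = 0"
    unfolding f0_def using fi by (simp add: \<mu>_def N.prob_space)
  define v where "v = (\<integral>x. (f0 x)\<^sup>2 \<partial>N)"
  have v0: "v \<ge> 0" unfolding v_def by simp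
  obtain K where K: "K \<ge> 0" "(\<integral>x. max 0 (h x - K) \<partial>N) \<le> \<epsilon> / 2"
    using truncated_tail_tendsto_0[OF h h_pos, of "\<epsilon> / 2"] \<open>\<epsilon> > 0\<close> by auto
  \<comment> \<open>Chosen so that \<open>n \<ge> n0\<close> forces
    \<open>K * (v / n) \<le> \<epsilon> / 2\<close>; the \<open>+ 1\<close> keeps \<open>n\<close>
    positive.\<close>
  define n0 where "n0 = nat \<lceil>2 * K * v / \<epsilon>\<rceil> + 1"
  show ?thesis
  proof (rule exI[of _ n0], intro allI impI)
    fix n t :: nat assume n: "n \<ge> n0" and t: "t < n"
    let ?P = "Pi\<^sub>M {..<n} (\<lambda>_. N)"
    let ?A = "{\<omega>. (\<Sum>t<n. f (\<omega> t)) > real n * B}"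
    have n1: "n \<ge> 1" using n by (simp add: n0_def)
    note sq = has_bochner_integral_PiM_sum_square[OF N finite_lessThan[of n] f0i f02 f0mean]
    \<comment> \<open>Pointwise form of Chebyshev's inequality: since \<open>B\<close> exceeds the
      mean by at least 1, the centred sum is at least \<open>n\<close> on the event.\<close>
    have pt: "indicator ?A \<omega> \<le> ennreal ((\<Sum>t<n. f0 (\<omega> t))\<^sup>2 / (real n)\<^sup>2)" for \<omega>
    proof (cases "\<omega> \<in> ?A")
      case True
      have "(\<Sum>t<n. f0 (\<omega> t)) = (\<Sum>t<n. f (\<omega> t)) - real n * \<mu>"
        by (simp add: f0_def sum_subtractf)
      moreover have "real n * B \<ge> real n * \<mu> + real n"
        using B mult_left_mono[of "\<mu> + 1" B "real n"] by (simp add: \<mu>_def algebra_simps)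
      ultimately have "(\<Sum>t<n. f0 (\<omega> t)) \<ge> real n" using True by simp
      then have "(\<Sum>t<n. f0 (\<omega> t))\<^sup>2 \<ge> (real n)\<^sup>2" by (intro power_mono) auto
      then have "1 \<le> (\<Sum>t<n. f0 (\<omega> t))\<^sup>2 / (real n)\<^sup>2" using n1 by (simp add: field_simps)
      then show ?thesis using True by (simp add: ennreal_1[symmetric] del: ennreal_1)
    qed simp
    have Pmeas[measurable]: "(\<lambda>\<omega>. \<omega> s) \<in> measurable ?P N" if "s < n" for s
      using that by simp
    have "(\<integral>\<^sup>+\<omega>. indicator ?A \<omega> \<partial>?P) \<le> (\<integral>\<^sup>+\<omega>. ennreal ((\<Sum>t<n. f0 (\<omega> t))\<^sup>2 / (real n)\<^sup>2) \<partial>?P)"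
      by (intro nn_integral_mono pt)
    also have "\<dots> = ennreal (\<integral>\<omega>. (\<Sum>t<n. f0 (\<omega> t))\<^sup>2 / (real n)\<^sup>2 \<partial>?P)"
      using sq by (intro nn_integral_eq_integral) (auto simp: has_bochner_integral_iff)
    also have "\<dots> = ennreal (v / real n)"
      using sq n1 by (simp add: has_bochner_integral_iff v_def power2_eq_square)
    finally have PA: "(\<integral>\<^sup>+\<omega>. indicator ?A \<omega> \<partial>?P) \<le> ennreal (v / real n)" .
    have Kn: "K * (v / real n) \<le> \<epsilon> / 2"
    proof -
      have "2 * K * v / \<epsilon> \<le> real n0" unfolding n0_def by linarith
      also have "\<dots> \<le> real n" using n by simp
      finally show ?thesis using \<open>\<epsilon> > 0\<close> n1 by (simp add: field_simps)
    qed
    have "(\<integral>\<^sup>+\<omega>. ennreal (h (\<omega> t)) * indicator ?A \<omega> \<partial>?P)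
      \<le> (\<integral>\<^sup>+\<omega>. ennreal (max 0 (h (\<omega> t) - K)) + ennreal K * indicator ?A \<omega> \<partial>?P)"
    proof (rule nn_integral_mono)
      fix \<omega>
      have "ennreal (h (\<omega> t)) \<le> ennreal (max 0 (h (\<omega> t) - K) + K)"
        using K by (intro ennreal_leI) auto
      also have "\<dots> = ennreal (max 0 (h (\<omega> t) - K)) + ennreal K"
        using K by (intro ennreal_plus) auto
      finally show "ennreal (h (\<omega> t)) * indicator ?A \<omega> \<le>
          ennreal (max 0 (h (\<omega> t) - K)) + ennreal K * indicator ?A \<omega>"
        by (simp add: indicator_def)
    qed
    also have "\<dots> = (\<integral>\<^sup>+\<omega>. ennreal (max 0 (h (\<omega> t) - K)) \<partial>?P) + ennreal K * (\<integral>\<^sup>+\<omega>. indicator ?A \<omega> \<partial>?P)"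
    proof -
      have [measurable]: "(\<lambda>\<omega>. \<omega> t) \<in> measurable ?P N" using t by simp
      have "(\<lambda>\<omega>. \<Sum>t<n. f (\<omega> t)) \<in> borel_measurable ?P"
        by (rule borel_measurable_sum) auto
      then have [measurable]: "indicator ?A \<in> borel_measurable ?P"
        by (intro borel_measurable_indicator') (simp add: pred_def[symmetric])
      show ?thesis
        by (subst nn_integral_add) (auto simp: nn_integral_cmult)
    qed
    also have "(\<integral>\<^sup>+\<omega>. ennreal (max 0 (h (\<omega> t) - K)) \<partial>?P) = (\<integral>\<^sup>+x. ennreal (max 0 (h x - K)) \<partial>N)"
      using nn_integral_PiM_component[OF N, of t "{..<n}" "\<lambda>x. ennreal (max 0 (h x - K))"] t by simp
    also have "\<dots> = ennreal (\<integral>x. max 0 (h x - K) \<partial>N)"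
      using h by (intro nn_integral_eq_integral) auto
    also have "ennreal (\<integral>x. max 0 (h x - K) \<partial>N) + ennreal K * (\<integral>\<^sup>+\<omega>. indicator ?A \<omega> \<partial>?P)
        \<le> ennreal (\<epsilon> / 2) + ennreal K * ennreal (v / real n)"
      using K PA by (intro add_mono mult_left_mono ennreal_leI) auto
    also have "\<dots> = ennreal (\<epsilon> / 2 + K * (v / real n))"
      using K v0 \<open>\<epsilon> > 0\<close> by (subst ennreal_plus) (auto simp flip: ennreal_mult)
    also have "\<dots> \<le> ennreal \<epsilon>" using Kn by (intro ennreal_leI) linarith
    finally show "(\<integral>\<^sup>+\<omega>. ennreal (h (\<omega> t)) * indicator ?A \<omega> \<partial>?P) \<le> ennreal \<epsilon>" .
  qed
qed

section \<open>Counting integer codewords\<close>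

text \<open>Extensionality pins the values outside \<open>{..<n}\<close>, which keeps the set finite
  and makes equality of blocks the same as equality of functions.\<close>

definition int_codebook :: "nat \<Rightarrow> real \<Rightarrow> (nat \<Rightarrow> int) set" where
  "int_codebook n B = {k \<in> {..<n} \<rightarrow>\<^sub>E UNIV. (\<Sum>t<n. \<bar>real_of_int (k t)\<bar>) \<le> real n * B}"

text \<open>A two-sided geometric series with ratio \<open>exp (- l)\<close>: each side sums to at
  most \<open>1 / (exp l - 1)\<close>, and \<open>exp l \<ge> 1 + l\<close>. The bound does not
  depend on \<open>L\<close>.\<close>

lemma sum_exp_neg_abs_le:
  assumes "l > 0"
  shows "(\<Sum>j\<in>{-int L..int L}. exp (- l * \<bar>real_of_int j\<bar>)) \<le> 1 + 2 / l"
proof -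
  define q where "q = exp (- l)"
  have q: "0 < q" "q < 1" using assms by (auto simp: q_def)
  have eq: "(\<Sum>j\<in>{-int L..int L}. exp (- l * \<bar>real_of_int j\<bar>)) = 1 + 2 * (\<Sum>i<L. q ^ Suc i)"
  proof (induction L)
    case (Suc L)
    have "{-int (Suc L)..int (Suc L)} = insert (- int (Suc L)) (insert (int (Suc L)) {-int L..int L})"
      by auto
    moreover have "exp (- l * real (Suc L)) = q ^ Suc L"
      by (simp add: q_def exp_of_nat_mult[symmetric] algebra_simps flip: exp_add)
    ultimately show ?case using Suc by (simp add: algebra_simps)
  qed simp
  have "(\<Sum>i<L. q ^ Suc i) = q * (\<Sum>i<L. q ^ i)" by (simp add: sum_distrib_left)
  also have "\<dots> \<le> q * (1 / (1 - q))"
    using q by (intro mult_left_mono) (auto simp: sum_gp_strict divide_right_mono)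
  also have "\<dots> = 1 / (exp l - 1)"
    using assms by (simp add: q_def exp_minus field_simps)
  also have "\<dots> \<le> 1 / l"
    using assms exp_ge_add_one_self[of l] by (intro divide_left_mono mult_pos_pos) linarith+
  finally show ?thesis unfolding eq by simp
qed

text \<open>Chernoff-style count: weight each codeword by \<open>exp (n - \<parallel>k\<parallel>\<^sub>1 / B) \<ge> 1\<close> and sum the weights over a
  box, where they factorise.\<close>

lemma int_codebook_finite: "finite (int_codebook n B)"
  and card_int_codebook_le:
    "B > 0 \<Longrightarrow> real (card (int_codebook n B)) \<le> exp (real n * (1 + ln (1 + 2 * B)))"
proof -
  define L where "L = nat \<lceil>real n * B\<rceil>"
  let ?P = "{..<n} \<rightarrow>\<^sub>E {-int L..int L}"
  \<comment> \<open>No coordinate exceeds the whole norm, so the codebook lies in a finite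
    box.\<close>
  have sub: "int_codebook n B \<subseteq> ?P"
  proof
    fix k assume k: "k \<in> int_codebook n B"
    have "k t \<in> {-int L..int L}" if "t < n" for t
    proof -
      have "\<bar>real_of_int (k t)\<bar> \<le> (\<Sum>t<n. \<bar>real_of_int (k t)\<bar>)"
        using that by (intro member_le_sum) auto
      also have "\<dots> \<le> real n * B" using k by (simp add: int_codebook_def)
      finally have "\<bar>k t\<bar> \<le> int L" unfolding L_def by linarith
      then show ?thesis by auto
    qed
    then show "k \<in> ?P" using k by (auto simp: int_codebook_def PiE_iff)
  qed
  have finP: "finite ?P" by (intro finite_PiE) auto
  show fin: "finite (int_codebook n B)" using sub finP by (rule finite_subset)
  assume B: "B > 0"
  let ?w = "\<lambda>k. (\<Prod>t<n. exp (- (1 / B) * \<bar>real_of_int (k t)\<bar>))"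
  have "real (card (int_codebook n B)) = (\<Sum>k\<in>int_codebook n B. 1)" by simp
  also have "\<dots> \<le> (\<Sum>k\<in>int_codebook n B. exp (real n) * ?w k)"
  proof (rule sum_mono)
    fix k assume k: "k \<in> int_codebook n B"
    have "exp (real n) * ?w k = exp (real n - (\<Sum>t<n. \<bar>real_of_int (k t)\<bar>) / B)"
      by (simp add: exp_sum[symmetric] sum_negf sum_divide_distrib flip: exp_add)
    moreover have "(\<Sum>t<n. \<bar>real_of_int (k t)\<bar>) / B \<le> real n"
      using k B by (simp add: int_codebook_def field_simps)
    ultimately show "1 \<le> exp (real n) * ?w k" by simp
  qed
  also have "\<dots> \<le> (\<Sum>k\<in>?P. exp (real n) * ?w k)"
    using finP sub by (intro sum_mono2) (auto intro!: mult_nonneg_nonneg prod_nonneg)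
  also have "\<dots> = exp (real n) * (\<Prod>t<n. \<Sum>j\<in>{-int L..int L}. exp (- (1 / B) * \<bar>real_of_int j\<bar>))"
    by (subst prod_sum_PiE) (auto simp: sum_distrib_left)
  \<comment> \<open>With \<open>l = 1 / B\<close> each coordinate contributes at most
    \<open>1 + 2 * B\<close>, so the side length of the box drops out.\<close>
  also have "\<dots> \<le> exp (real n) * (\<Prod>t<n. 1 + 2 / (1 / B))"
    using B by (intro mult_left_mono prod_mono conjI sum_exp_neg_abs_le sum_nonneg) auto
  also have "\<dots> = exp (real n) * exp (real n * ln (1 + 2 * B))"
    using B by (simp add: exp_of_nat_mult)
  finally show "real (card (int_codebook n B)) \<le> exp (real n * (1 + ln (1 + 2 * B)))"
    by (simp add: exp_add[symmetric] distrib_left)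
qed

section \<open>Dithered quantisation of the source\<close>

definition unit_unif :: "real measure" where
  "unit_unif = restrict_space lborel {0..1}"

lemma prob_space_unit_unif: "prob_space unit_unif"
  by standard (simp add: unit_unif_def space_restrict_space emeasure_restrict_space)

lemma space_unit_unif[simp]: "space unit_unif = {0..1}"
  by (simp add: unit_unif_def space_restrict_space)

lemma measurable_unit_unif: "f \<in> borel_measurable borel \<Longrightarrow> f \<in> borel_measurable unit_unif"
  unfolding unit_unif_def by (rule measurable_restrict_space1) simp

text \<open>Error of a unit-step quantiser with subtractive dither: the cell of \<open>x + u\<close>
  is represented by its midpoint, hence the \<open>1 / 2\<close>, and the dither is taken off again.
  Step \<Delta> is handled by rescaling the argument to \<open>x / \<Delta>\<close>.\<close>

definition quant_err :: "real \<Rightarrow> real \<Rightarrow> real" where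
  "quant_err u x = real_of_int \<lfloor>x + u\<rfloor> - u + 1 / 2 - x"

lemma abs_quant_err_le: "\<bar>quant_err u x\<bar> \<le> 1 / 2"
  unfolding quant_err_def by linarith

text \<open>As \<open>u\<close> runs through the unit interval the floor jumps once, at
  \<open>a = 1 - frac x\<close>, so the error is an explicit sawtooth. Its constant, linear and jump
  parts integrate to \<open>1 / 2 - frac x\<close>, \<open>- 1 / 2\<close> and
  \<open>frac x\<close>.\<close>

lemma integral_quant_err: "(\<integral>u. quant_err u x \<partial>unit_unif) = 0"
proof -
  define a where "a = 1 - frac x"
  have a: "0 < a" "a \<le> 1" by (simp_all add: a_def frac_lt_1)
  have eq: "indicator {0..1} u *\<^sub>R quant_err u x =
      (1 / 2 - frac x) * indicator {0..1} u - u ^ 1 * indicator {0..1} u + indicator {a..1} u"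
    for u :: real
  proof (cases "u \<in> {0..1}")
    case True
    have "\<lfloor>x + u\<rfloor> = \<lfloor>x\<rfloor> + (if a \<le> u then 1 else 0)"
      using True frac_lt_1[of x] of_int_floor_le[of x] unfolding a_def frac_def
      by (intro floor_unique; simp split: if_splits; linarith)
    then show ?thesis using True
      by (auto simp: quant_err_def frac_def indicator_def a_def)
  qed (use a in \<open>auto simp: indicator_def\<close>)
  have i1: "integrable lborel (\<lambda>u::real. u ^ 1 * indicator {0..1} u)"
    by (rule borel_integrable_atLeastAtMost) auto
  have i2: "integrable lborel (indicator {b..1::real} :: real \<Rightarrow> real)" for b
    by (simp add: integrable_indicator_iff emeasure_lborel_Icc_eq)
  have "(\<integral>u. quant_err u x \<partial>unit_unif) =
     (\<integral>u. indicator {0..1} u *\<^sub>R quant_err u x \<partial>lborel)"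
    unfolding unit_unif_def by (rule integral_restrict_space) simp
  also have "\<dots> = (1 / 2 - frac x) - (\<integral>u. u ^ 1 * indicator {0..1} u \<partial>lborel) + (1 - a)"
    unfolding eq using i1 i2 a
    by (subst Bochner_Integration.integral_add Bochner_Integration.integral_diff;
        (intro Bochner_Integration.integrable_diff integrable_mult_right)?; simp)+
  also have "\<dots> = 0"
    using integral_power[of 0 1 1] by (simp add: a_def)
  finally show ?thesis .
qed

text \<open>Averaged over the dither \<open>u\<close> the quantisation error vanishes pointwise.\<close>

lemma exists_dither_nonneg_correlation:
  fixes V :: "'a \<Rightarrow> real" and Y :: "nat \<Rightarrow> 'a \<Rightarrow> real"
  assumes P: "prob_space P" and V: "integrable P V"
    and Y: "\<And>i. i < M \<Longrightarrow> Y i \<in> borel_measurable P"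
  shows "\<exists>u\<in>{0..1}. (\<integral>s. V s * (\<Sum>i<M. quant_err u (Y i s)) \<partial>P) \<ge> 0"
proof (rule ccontr)
  assume neg: "\<not> ?thesis"
  interpret P: prob_space P by fact
  interpret U: prob_space unit_unif by (rule prob_space_unit_unif)
  interpret UP: pair_sigma_finite unit_unif P ..
  have [measurable]: "V \<in> borel_measurable P" using V by auto
  \<comment> \<open>Bounded errors make a multiple of \<open>V\<close> dominate, which gives the
    joint integrability needed to exchange the two integrals.\<close>
  have bd: "norm (V s * (\<Sum>i<M. quant_err u (Y i s))) \<le> norm (real M * V s)" for u s
  proof -
    have "\<bar>\<Sum>i<M. quant_err u (Y i s)\<bar> \<le> (\<Sum>i<M. 1)"
      by (intro order.trans[OF sum_abs] sum_mono order.trans[OF abs_quant_err_le]) simp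
    then have "\<bar>V s\<bar> * \<bar>\<Sum>i<M. quant_err u (Y i s)\<bar> \<le> \<bar>V s\<bar> * real M"
      by (intro mult_left_mono) auto
    then show ?thesis by (simp add: abs_mult mult.commute)
  qed
  have int: "integrable (unit_unif \<Otimes>\<^sub>M P) (\<lambda>(u, s). V s * (\<Sum>i<M. quant_err u (Y i s)))"
  proof (rule Bochner_Integration.integrable_bound)
    show "integrable (unit_unif \<Otimes>\<^sub>M P) (\<lambda>z. real M * V (snd z))"
      using has_bochner_integral_pair_mult[OF U.prob_space_axioms P U.integrable_const[of "real M"] V]
      by (auto simp: has_bochner_integral_iff)
    have [measurable]: "fst \<in> borel_measurable (unit_unif \<Otimes>\<^sub>M P)"
      using measurable_compose[OF measurable_fst measurable_unit_unif[OF measurable_ident_sets[OF refl]]] .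
    have "(\<lambda>(u, s). quant_err u (Y i s)) \<in> borel_measurable (unit_unif \<Otimes>\<^sub>M P)" if "i < M" for i
      unfolding quant_err_def split_beta' using Y[OF that] by measurable
    then show "(\<lambda>(u, s). V s * (\<Sum>i<M. quant_err u (Y i s))) \<in> borel_measurable (unit_unif \<Otimes>\<^sub>M P)"
      unfolding split_beta' by (intro borel_measurable_times borel_measurable_sum) auto
  qed (use bd in auto)
  have "(\<integral>u. \<integral>s. V s * (\<Sum>i<M. quant_err u (Y i s)) \<partial>P \<partial>unit_unif) =
        (\<integral>s. \<integral>u. V s * (\<Sum>i<M. quant_err u (Y i s)) \<partial>unit_unif \<partial>P)"
    using UP.Fubini_integral[OF int] by simp
  also have "\<dots> = 0"
  proof -
    have qm: "(\<lambda>u. quant_err u x) \<in> borel_measurable unit_unif" for x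
      unfolding quant_err_def by (rule measurable_unit_unif) measurable
    have "integrable unit_unif (\<lambda>u. quant_err u x)" for x
      by (rule U.integrable_const_bound[where B = "1/2"])
         (use abs_quant_err_le qm in auto)
    then show ?thesis by (simp add: Bochner_Integration.integral_sum integral_quant_err)
  qed
  finally have z: "(\<integral>u. \<integral>s. V s * (\<Sum>i<M. quant_err u (Y i s)) \<partial>P \<partial>unit_unif) = 0" .
  \<comment> \<open>If every dither gave a negative correlation, the average over the probability
    measure \<open>unit_unif\<close> would be strictly negative, against the value 0 just
    found.\<close>
  have "(\<integral>u. \<integral>s. V s * (\<Sum>i<M. quant_err u (Y i s)) \<partial>P \<partial>unit_unif) < 0"
    using UP.integrable_fst[OF int] neg by (intro U.expectation_less AE_I2) (auto simp: not_le)
  with z show False by simp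
qed

section \<open>The linear MMSE estimator and its single-letter quantised version\<close>

locale ceo_source =
  fixes p :: "real \<Rightarrow> real" and s2 :: real and M :: nat
  assumes M_pos: "M \<ge> 1"
    and s2_pos: "s2 > 0"
    and p_meas[measurable]: "p \<in> borel_measurable lborel"
    and p_nonneg: "p x \<ge> 0"
    and p_prob: "(\<integral>\<^sup>+ x. ennreal (p x) \<partial>lborel) = 1"
    and p_var_fin: "integrable lborel (\<lambda>x. x\<^sup>2 * p x)"
    and p_var_pos: "var_X p > 0"
begin

abbreviation "PX \<equiv> density lborel (\<lambda>x. ennreal (p x))"
abbreviation "PW \<equiv> density lborel (\<lambda>x. ennreal (normal_density 0 (sqrt s2) x))"
abbreviation "P \<equiv> src_meas p s2 M"

definition "\<mu> = (\<integral>x. x * p x \<partial>lborel)"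
text \<open>Weight of each observation in the linear MMSE estimator of the source. The remaining
  weight \<open>1 - c * real M\<close>, which falls on the mean, equals
  \<open>s2 / (real M * var_X p + s2)\<close>.\<close>

definition "c = var_X p / (real M * var_X p + s2)"
definition "Y i s = fst s + (snd s i :: real)" for s :: "real \<times> (nat \<Rightarrow> real)"
text \<open>\<open>V\<close> is the error of the linear MMSE estimator from the unquantised observations.\<close>

definition "V s = fst s - (1 - c * real M) * \<mu> - c * (\<Sum>i<M. Y i s)"

lemma c_pos: "c > 0"
  unfolding c_def using M_pos s2_pos p_var_pos by (intro divide_pos_pos add_nonneg_pos) auto

lemma prob_space_PX: "prob_space PX"
  using p_prob by (intro prob_spaceI) (simp add: emeasure_density)

lemma prob_space_PW: "prob_space PW"
  using s2_pos by (intro prob_space_normal_density) simp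

lemma prob_space_PWs: "prob_space (\<Pi>\<^sub>M i\<in>{..<M}. PW)"
  by (intro prob_space_PiM prob_space_PW)

lemma prob_space_P: "prob_space P"
proof -
  interpret A: prob_space PX by (rule prob_space_PX)
  interpret B: prob_space "\<Pi>\<^sub>M i\<in>{..<M}. PW" by (rule prob_space_PWs)
  interpret pair_prob_space PX "\<Pi>\<^sub>M i\<in>{..<M}. PW" ..
  show ?thesis unfolding src_meas_def by (rule prob_space_axioms)
qed

lemma measurable_fst_P[measurable]: "fst \<in> borel_measurable P"
  unfolding src_meas_def by (rule measurable_compose[OF measurable_fst]) simp

lemma measurable_noise[measurable]: "i < M \<Longrightarrow> (\<lambda>s. snd s i) \<in> borel_measurable P"
  unfolding src_meas_def
  by (rule measurable_compose[OF measurable_snd])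
     (use measurable_component_singleton[of i "{..<M}" "\<lambda>_. PW"] in simp)

lemma measurable_Y[measurable]: "i < M \<Longrightarrow> Y i \<in> borel_measurable P"
  unfolding Y_def[abs_def] by simp

lemma integrable_PX_iff:
  "f \<in> borel_measurable lborel \<Longrightarrow> integrable PX f \<longleftrightarrow> integrable lborel (\<lambda>x. p x * f x)"
  using p_nonneg by (subst integrable_density) auto

lemma X_square_integrable: "integrable PX (\<lambda>x. x\<^sup>2)"
  using p_var_fin by (simp add: integrable_PX_iff mult.commute)

lemma X_integrable: "integrable PX (\<lambda>x. x)"
proof -
  interpret prob_space PX by (rule prob_space_PX)
  show ?thesis by (rule square_integrable_imp_integrable[OF _ X_square_integrable]) simp
qed

lemma X_mean: "(\<integral>x. x \<partial>PX) = \<mu>"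
  using p_nonneg by (subst integral_density) (auto simp: \<mu>_def mult.commute)

lemma X_var: "has_bochner_integral PX (\<lambda>x. (x - \<mu>)\<^sup>2) (var_X p)"
proof -
  interpret prob_space PX by (rule prob_space_PX)
  have m2: "(\<integral>x. x\<^sup>2 \<partial>PX) = (\<integral>x. x\<^sup>2 * p x \<partial>lborel)"
    using p_nonneg by (subst integral_density) (auto simp: mult.commute)
  show ?thesis
    using variance_eq[OF X_integrable X_square_integrable] X_integrable X_square_integrable
    by (simp add: has_bochner_integral_iff X_mean m2 var_X_def \<mu>_def[symmetric] power2_diff)
qed

lemma W_mean: "has_bochner_integral PW (\<lambda>x. x) 0"
  using normal_moment_nz_1[of "sqrt s2" 0] s2_pos
  by (subst has_bochner_integral_density) auto

lemma W_var: "has_bochner_integral PW (\<lambda>x. x\<^sup>2) s2"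
  using normal_moment_even[of "sqrt s2" 0 1] s2_pos
  by (subst has_bochner_integral_density) auto

lemma noise_sum_square:
  "has_bochner_integral (\<Pi>\<^sub>M i\<in>{..<M}. PW) (\<lambda>w. (\<Sum>i<M. w i)\<^sup>2) (real M * s2)"
  using has_bochner_integral_PiM_sum_square[OF prob_space_PW finite_lessThan[of M], of "\<lambda>x. x"]
    W_mean W_var by (simp add: has_bochner_integral_iff)

lemma noise_sum_mean:
  "has_bochner_integral (\<Pi>\<^sub>M i\<in>{..<M}. PW) (\<lambda>w. \<Sum>i<M. w i) 0"
proof -
  have "has_bochner_integral (\<Pi>\<^sub>M i\<in>{..<M}. PW) (\<lambda>w. \<Sum>i<M. w i) (\<Sum>i<M. \<integral>x. x \<partial>PW)"
    using W_mean
    by (intro has_bochner_integral_sum has_bochner_integral_PiM_component prob_space_PW)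
       (auto simp: has_bochner_integral_iff)
  then show ?thesis using W_mean by (simp add: has_bochner_integral_iff)
qed

lemma V_eq: "V s = (1 - c * real M) * (fst s - \<mu>) - c * (\<Sum>i<M. snd s i)"
  by (simp add: V_def Y_def sum.distrib algebra_simps)

text \<open>By \<open>V_eq\<close> the error is a combination of the centred source and the summed
  noise. These are independent and centred, so the cross term vanishes and two variances
  remain.\<close>

lemma V_second_moment: "has_bochner_integral P (\<lambda>s. (V s)\<^sup>2) (D_N0 (var_X p) s2 M)"
proof -
  interpret A: prob_space PX by (rule prob_space_PX)
  interpret B: prob_space "\<Pi>\<^sub>M i\<in>{..<M}. PW" by (rule prob_space_PWs)
  let ?r = "1 - c * real M" and ?S = "\<lambda>w::nat \<Rightarrow> real. \<Sum>i<M. w i"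
  note mult = has_bochner_integral_pair_mult[OF prob_space_PX prob_space_PWs]
  have 1: "has_bochner_integral P (\<lambda>s. (fst s - \<mu>)\<^sup>2) (var_X p)"
    using mult[of "\<lambda>x. (x - \<mu>)\<^sup>2" "\<lambda>_. 1"] X_var
    by (simp add: src_meas_def has_bochner_integral_iff B.prob_space)
  have 2: "has_bochner_integral P (\<lambda>s. (?S (snd s))\<^sup>2) (real M * s2)"
    using mult[of "\<lambda>_. 1" "\<lambda>w. (?S w)\<^sup>2"] noise_sum_square A.prob_space
    by (simp add: src_meas_def has_bochner_integral_iff)
  have 3: "has_bochner_integral P (\<lambda>s. (fst s - \<mu>) * ?S (snd s)) 0"
    using mult[of "\<lambda>x. x - \<mu>" ?S] noise_sum_mean X_integrable
    by (simp add: src_meas_def has_bochner_integral_iff)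
  have eq: "(V s)\<^sup>2 = ?r\<^sup>2 * (fst s - \<mu>)\<^sup>2 - (2 * ?r * c) * ((fst s - \<mu>) * ?S (snd s)) + c\<^sup>2 * (?S (snd s))\<^sup>2" for s
    unfolding V_eq by (simp add: power2_eq_square algebra_simps)
  have pos: "real M * var_X p + s2 > 0"
    using s2_pos p_var_pos by (intro add_nonneg_pos) auto
  have r: "?r = s2 / (real M * var_X p + s2)"
    unfolding c_def using pos by (simp add: field_simps)
  have "?r\<^sup>2 * var_X p - (2 * ?r * c) * 0 + c\<^sup>2 * (real M * s2) = D_N0 (var_X p) s2 M"
  proof -
    let ?T = "real M * var_X p + s2"
    \<comment> \<open>Over the common denominator \<open>?T\<^sup>2\<close>, the factor
      \<open>s2 + real M * var_X p = ?T\<close> splits off the numerator.\<close>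
    have "?r\<^sup>2 * var_X p + c\<^sup>2 * (real M * s2) = (var_X p * s2) * ?T / ?T\<^sup>2"
      unfolding r unfolding c_def by (simp add: power_divide power2_eq_square add_divide_distrib[symmetric] algebra_simps)
    also have "\<dots> = (var_X p * s2) / ?T"
      using pos by (simp add: power2_eq_square)
    finally show ?thesis by (simp add: D_N0_def)
  qed
  moreover have "has_bochner_integral P (\<lambda>s. (V s)\<^sup>2)
      (?r\<^sup>2 * var_X p - (2 * ?r * c) * 0 + c\<^sup>2 * (real M * s2))"
    unfolding eq
    by (intro has_bochner_integral_add has_bochner_integral_diff has_bochner_integral_mult_right 1 2 3)
  ultimately show ?thesis by simp
qed

lemma Y_square_integrable:
  assumes "i < M" shows "integrable P (\<lambda>s. (Y i s)\<^sup>2)"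
proof -
  interpret A: prob_space PX by (rule prob_space_PX)
  interpret B: prob_space "\<Pi>\<^sub>M i\<in>{..<M}. PW" by (rule prob_space_PWs)
  note mult = has_bochner_integral_pair_mult[OF prob_space_PX prob_space_PWs]
  have 1: "integrable P (\<lambda>s. (fst s)\<^sup>2)"
    using mult[of "\<lambda>x. x\<^sup>2" "\<lambda>_. 1"] X_square_integrable
    by (simp add: src_meas_def has_bochner_integral_iff)
  have "integrable (\<Pi>\<^sub>M i\<in>{..<M}. PW) (\<lambda>w. (w i)\<^sup>2)"
    using has_bochner_integral_PiM_component[OF prob_space_PW, of i "{..<M}" "\<lambda>x. x\<^sup>2"] W_var assms
    by (auto simp: has_bochner_integral_iff)
  then have 2: "integrable P (\<lambda>s. (snd s i)\<^sup>2)"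
    using mult[of "\<lambda>_. 1" "\<lambda>w. (w i)\<^sup>2"]
    by (simp add: src_meas_def has_bochner_integral_iff)
  show ?thesis
  proof (rule Bochner_Integration.integrable_bound)
    show "integrable P (\<lambda>s. 2 * (fst s)\<^sup>2 + 2 * (snd s i)\<^sup>2)" using 1 2 by auto
    show "(\<lambda>s. (Y i s)\<^sup>2) \<in> borel_measurable P" using assms by simp
    show "AE s in P. norm ((Y i s)\<^sup>2) \<le> norm (2 * (fst s)\<^sup>2 + 2 * (snd s i)\<^sup>2)"
    proof (rule AE_I2)
      fix s :: "real \<times> (nat \<Rightarrow> real)"
      have "(fst s - snd s i)\<^sup>2 \<ge> 0" by simp
      then have "(Y i s)\<^sup>2 \<le> 2 * (fst s)\<^sup>2 + 2 * (snd s i)\<^sup>2"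
        by (simp add: Y_def power2_eq_square algebra_simps)
      then show "norm ((Y i s)\<^sup>2) \<le> norm (2 * (fst s)\<^sup>2 + 2 * (snd s i)\<^sup>2)" by simp
    qed
  qed
qed

text \<open>The linear MMSE formula with each observation replaced by the midpoint of its cell after
  removal of the dither. Here \<open>k\<close> is indexed by agents at one time instant, not by
  time.\<close>

definition recon :: "real \<Rightarrow> real \<Rightarrow> (nat \<Rightarrow> int) \<Rightarrow> real" where
  "recon \<Delta> u k = (1 - c * real M) * \<mu> + c * (\<Sum>i<M. \<Delta> * (real_of_int (k i) - u + 1 / 2))"

text \<open>The error is \<open>V - c * \<Delta> * E\<close> with \<open>E\<close> the sum of the
  normalised quantisation errors. The cross term carries the factor
  \<open>- 2 * c * \<Delta>\<close>, so a dither with nonnegative correlation cannot increase the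
  distortion through it; only the term of order \<Delta> squared is paid.\<close>

lemma exists_dither_single_letter:
  assumes \<Delta>: "\<Delta> > 0"
  shows "\<exists>u\<in>{0..1}. (\<integral>\<^sup>+s. ennreal ((fst s - recon \<Delta> u (\<lambda>i. \<lfloor>Y i s / \<Delta> + u\<rfloor>))\<^sup>2) \<partial>P)
    \<le> ennreal (D_N0 (var_X p) s2 M + (c * real M * \<Delta> / 2)\<^sup>2)"
proof -
  interpret P: prob_space P by (rule prob_space_P)
  have Vm[measurable]: "V \<in> borel_measurable P" unfolding V_def by simp
  have Vi: "integrable P V"
    using P.square_integrable_imp_integrable[OF Vm] V_second_moment by (auto simp: has_bochner_integral_iff)
  obtain u where u: "u \<in> {0..1}"
    and corr: "(\<integral>s. V s * (\<Sum>i<M. quant_err u (Y i s / \<Delta>)) \<partial>P) \<ge> 0"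
    using exists_dither_nonneg_correlation[OF prob_space_P Vi, of M "\<lambda>i s. Y i s / \<Delta>"] by auto
  define E where "E s = (\<Sum>i<M. quant_err u (Y i s / \<Delta>))" for s
  have Em[measurable]: "E \<in> borel_measurable P"
    unfolding E_def quant_err_def
  proof (rule borel_measurable_sum)
    fix i assume "i \<in> {..<M}"
    then have [measurable]: "Y i \<in> borel_measurable P" by simp
    show "(\<lambda>s. real_of_int \<lfloor>Y i s / \<Delta> + u\<rfloor> - u + 1 / 2 - Y i s / \<Delta>) \<in> borel_measurable P"
      by measurable
  qed
  have Ebd: "\<bar>E s\<bar> \<le> real M / 2" for s
  proof -
    have "\<bar>E s\<bar> \<le> (\<Sum>i<M. 1 / 2)"
      unfolding E_def by (intro order.trans[OF sum_abs] sum_mono abs_quant_err_le)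
    then show ?thesis by simp
  qed
  have err: "fst s - recon \<Delta> u (\<lambda>i. \<lfloor>Y i s / \<Delta> + u\<rfloor>) = V s - c * \<Delta> * E s" for s
  proof -
    have "\<Delta> * (real_of_int \<lfloor>Y i s / \<Delta> + u\<rfloor> - u + 1 / 2) = Y i s + \<Delta> * quant_err u (Y i s / \<Delta>)" for i
      using \<Delta> by (simp add: quant_err_def algebra_simps)
    then show ?thesis
      by (simp add: recon_def V_def E_def sum.distrib sum_distrib_left[symmetric] algebra_simps)
  qed
  have VE: "integrable P (\<lambda>s. V s * E s)"
  proof (rule Bochner_Integration.integrable_bound)
    show "integrable P (\<lambda>s. (real M / 2) * V s)" using Vi by simp
    show "AE s in P. norm (V s * E s) \<le> norm (real M / 2 * V s)"
    proof (rule AE_I2)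
      fix s
      show "norm (V s * E s) \<le> norm (real M / 2 * V s)"
        using mult_left_mono[OF Ebd[of s], of "\<bar>V s\<bar>"] by (simp add: abs_mult mult.commute)
    qed
  qed simp
  \<comment> \<open>Only the pure square of \<open>E\<close> is estimated; the cross term stays
    exact, since its sign is known only after integration.\<close>
  have pt: "(V s - c * \<Delta> * E s)\<^sup>2 \<le> (V s)\<^sup>2 - 2 * c * \<Delta> * (V s * E s) + (c * real M * \<Delta> / 2)\<^sup>2" for s
  proof -
    have "(E s)\<^sup>2 \<le> (real M / 2)\<^sup>2" using Ebd[of s] by (metis abs_ge_zero power2_abs power_mono)
    then have "(c * \<Delta>)\<^sup>2 * (E s)\<^sup>2 \<le> (c * \<Delta>)\<^sup>2 * (real M / 2)\<^sup>2" by (intro mult_left_mono) auto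
    then show ?thesis by (simp add: power2_diff power_mult_distrib power_divide algebra_simps)
  qed
  let ?F = "\<lambda>s. (V s)\<^sup>2 - 2 * c * \<Delta> * (V s * E s) + (c * real M * \<Delta> / 2)\<^sup>2"
  have Fi: "integrable P ?F" using VE V_second_moment by (auto simp: has_bochner_integral_iff)
  have Fpos: "?F s \<ge> 0" for s using order.trans[OF zero_le_power2 pt[of s]] .
  have "(\<integral>\<^sup>+s. ennreal ((fst s - recon \<Delta> u (\<lambda>i. \<lfloor>Y i s / \<Delta> + u\<rfloor>))\<^sup>2) \<partial>P) \<le> (\<integral>\<^sup>+s. ennreal (?F s) \<partial>P)"
    unfolding err by (intro nn_integral_mono ennreal_leI pt)
  also have "\<dots> = ennreal (\<integral>s. ?F s \<partial>P)"
    using Fi Fpos by (intro nn_integral_eq_integral) auto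
  also have "\<dots> \<le> ennreal (D_N0 (var_X p) s2 M + (c * real M * \<Delta> / 2)\<^sup>2)"
  proof (rule ennreal_leI)
    have "(\<integral>s. ?F s \<partial>P) = D_N0 (var_X p) s2 M - 2 * c * \<Delta> * (\<integral>s. V s * E s \<partial>P) + (c * real M * \<Delta> / 2)\<^sup>2"
      using VE V_second_moment by (simp add: has_bochner_integral_iff P.prob_space)
    also have "\<dots> \<le> D_N0 (var_X p) s2 M + (c * real M * \<Delta> / 2)\<^sup>2"
      using corr c_pos \<Delta> by (simp add: E_def)
    finally show "(\<integral>s. ?F s \<partial>P) \<le> D_N0 (var_X p) s2 M + (c * real M * \<Delta> / 2)\<^sup>2" .
  qed
  finally show ?thesis using u by blast
qed

end

section \<open>Achievability\<close>

lemma n_idx_ge_iff: "k \<le> n_idx n R \<longleftrightarrow> real k \<le> exp (real n * R)"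
  unfolding n_idx_def by (simp add: le_nat_iff le_floor_iff)

lemma restrict_in_space_PiM_borel[simp]:
  "restrict y I \<in> space (\<Pi>\<^sub>M t\<in>I. (borel :: real measure))"
  by (simp add: space_PiM)

text \<open>Each codeword has a measurable cell, cut out by finitely many floor conditions. A
  preimage is a finite union of such cells, together with the complement of all cells when the
  fallback zero block gets the index in question.\<close>

lemma measurable_block_quantiser:
  fixes b :: "(nat \<Rightarrow> int) \<Rightarrow> nat" and \<Delta> u B :: real
  assumes "\<Delta> > 0"
  shows "(\<lambda>y. b (let k = (\<lambda>t\<in>{..<n}. \<lfloor>y t / \<Delta> + u\<rfloor>)
              in if k \<in> int_codebook n B then k else (\<lambda>t\<in>{..<n}. 0)))
    \<in> measurable (\<Pi>\<^sub>M t\<in>{..<n}. borel) (count_space UNIV)" (is "?f \<in> measurable ?S _")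
proof -
  let ?k = "\<lambda>y. \<lambda>t\<in>{..<n}. \<lfloor>y t / \<Delta> + u\<rfloor>" and ?C = "int_codebook n B"
  have comp: "(\<lambda>y. y t) \<in> borel_measurable ?S" if "t < n" for t
    using measurable_component_singleton[of t "{..<n}" "\<lambda>_. borel"] that by simp
  have eq: "{y \<in> space ?S. ?k y = k} \<in> sets ?S" if k: "k \<in> ?C" for k
  proof -
    have "{y \<in> space ?S. ?k y = k} = {y \<in> space ?S. \<forall>t\<in>{..<n}. \<lfloor>y t / \<Delta> + u\<rfloor> = k t}"
      using k by (auto simp: int_codebook_def PiE_iff fun_eq_iff extensional_def restrict_def)
    also have "\<dots> \<in> sets ?S"
    proof (rule sets.sets_Collect_finite_All)
      fix t assume "t \<in> {..<n}"
      then have "(\<lambda>y. y t / \<Delta> + u) \<in> borel_measurable ?S"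
        by (intro borel_measurable_add borel_measurable_divide comp) auto
      note [measurable] = measurable_compose[OF this measurable_real_floor]
      show "{y \<in> space ?S. \<lfloor>y t / \<Delta> + u\<rfloor> = k t} \<in> sets ?S" by measurable
    qed simp
    finally show ?thesis .
  qed
  have eqU: "(\<Union>k\<in>A. {y \<in> space ?S. ?k y = k}) \<in> sets ?S" if "A \<subseteq> ?C" for A
    using that eq int_codebook_finite finite_subset by (intro sets.finite_UN) blast+
  have "?f -` {a} \<inter> space ?S \<in> sets ?S" for a
  proof -
    have "?f -` {a} \<inter> space ?S = (\<Union>k\<in>{k\<in>?C. b k = a}. {y \<in> space ?S. ?k y = k}) \<union>
      (if b (\<lambda>t\<in>{..<n}. 0) = a then space ?S - (\<Union>k\<in>?C. {y \<in> space ?S. ?k y = k}) else {})"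
      by (auto simp: Let_def split: if_splits)
    also have "\<dots> \<in> sets ?S" using eqU by (intro sets.Un) auto
    finally show ?thesis .
  qed
  then show ?thesis by (subst measurable_count_space_eq2_countable) auto
qed

text \<open>The two sides differ by a square divided by \<eta>. A small \<eta> keeps the coefficient
  of the main term near 1, at the expense of a large factor on the other term.\<close>

lemma square_add_le_weighted:
  fixes a b \<eta> :: real
  assumes "\<eta> > 0"
  shows "(a + b)\<^sup>2 \<le> (1 + \<eta>) * a\<^sup>2 + (1 + 1 / \<eta>) * b\<^sup>2"
proof -
  have "(1 + \<eta>) * a\<^sup>2 + (1 + 1 / \<eta>) * b\<^sup>2 - (a + b)\<^sup>2 = (\<eta> * a - b)\<^sup>2 / \<eta>"
    using assms by (simp add: power2_eq_square field_simps)
  also have "\<dots> \<ge> 0" using assms by simp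
  finally show ?thesis by linarith
qed

section \<open>The block code and its distortion\<close>

context ceo_source
begin

text \<open>A single bound on the mean absolute observation of every agent, so that all agents can
  share one rate; the leading 1 makes it positive.\<close>

definition "m = 1 + (\<Sum>i<M. \<integral>s. \<bar>Y i s\<bar> \<partial>P)"

lemma m_pos: "m > 0"
  unfolding m_def by (intro add_pos_nonneg sum_nonneg) auto

lemma Y_abs_integrable: "i < M \<Longrightarrow> integrable P (\<lambda>s. \<bar>Y i s\<bar>)"
proof -
  interpret P: prob_space P by (rule prob_space_P)
  show "i < M \<Longrightarrow> ?thesis"
    using P.square_integrable_imp_integrable[OF measurable_Y Y_square_integrable] by simp
qed

text \<open>Floor and dither each add at most 1 to the absolute value of the scaled observation,
  hence the 2. These are the moment conditions under which \<open>sum_exceedance_vanishes\<close>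
  applies to the norm of a quantised block.\<close>

lemma quantised_observation:
  assumes \<Delta>: "\<Delta> > 0" and u: "u \<in> {0..1}" and i: "i < M"
  defines "q \<equiv> \<lambda>s. \<bar>real_of_int \<lfloor>Y i s / \<Delta> + u\<rfloor>\<bar>"
  shows "q \<in> borel_measurable P"
    and "integrable P (\<lambda>s. (q s)\<^sup>2)"
    and "(\<integral>s. q s \<partial>P) \<le> m / \<Delta> + 2"
proof -
  interpret P: prob_space P by (rule prob_space_P)
  have [measurable]: "Y i \<in> borel_measurable P" using i by simp
  show qm[measurable]: "q \<in> borel_measurable P" unfolding q_def by measurable
  have bd: "q s \<le> \<bar>Y i s\<bar> / \<Delta> + 2" for s
  proof -
    have "\<bar>Y i s\<bar> / \<Delta> = \<bar>Y i s / \<Delta>\<bar>" using \<Delta> by simp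
    moreover have "0 \<le> u" "u \<le> 1" using u by auto
    ultimately show ?thesis unfolding q_def by linarith
  qed
  have q0: "q s \<ge> 0" for s by (simp add: q_def)
  show q2: "integrable P (\<lambda>s. (q s)\<^sup>2)"
  proof (rule Bochner_Integration.integrable_bound)
    show "integrable P (\<lambda>s. 2 / \<Delta>\<^sup>2 * (Y i s)\<^sup>2 + 8)"
      using Y_square_integrable[OF i] by auto
    show "AE s in P. norm ((q s)\<^sup>2) \<le> norm (2 / \<Delta>\<^sup>2 * (Y i s)\<^sup>2 + 8)"
    proof (rule AE_I2)
      fix s
      have "(q s)\<^sup>2 \<le> (\<bar>Y i s\<bar> / \<Delta> + 2)\<^sup>2" using bd q0 by (intro power_mono)
      also have "\<dots> \<le> (1 + 1) * (\<bar>Y i s\<bar> / \<Delta>)\<^sup>2 + (1 + 1 / 1) * 2\<^sup>2"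
        by (rule square_add_le_weighted) simp
      finally show "norm ((q s)\<^sup>2) \<le> norm (2 / \<Delta>\<^sup>2 * (Y i s)\<^sup>2 + 8)"
        by (simp add: power_divide)
    qed
  qed simp
  have "(\<integral>s. q s \<partial>P) \<le> (\<integral>s. \<bar>Y i s\<bar> / \<Delta> + 2 \<partial>P)"
    using P.square_integrable_imp_integrable[OF qm q2] Y_abs_integrable[OF i] bd
    by (intro integral_mono) auto
  also have "\<dots> = (\<integral>s. \<bar>Y i s\<bar> \<partial>P) / \<Delta> + 2"
    using Y_abs_integrable[OF i] by (simp add: P.prob_space)
  also have "(\<integral>s. \<bar>Y i s\<bar> \<partial>P) \<le> m"
    unfolding m_def using i member_le_sum[of i "{..<M}" "\<lambda>i. \<integral>s. \<bar>Y i s\<bar> \<partial>P"] by auto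
  finally show "(\<integral>s. q s \<partial>P) \<le> m / \<Delta> + 2"
    using \<Delta> by (auto simp: divide_right_mono)
qed

text \<open>Each agent sends the number of its quantised block in the codebook, or that of the zero
  block if the norm is too large. The decoder error is the single-letter error plus a penalty
  supported on the atypical blocks.\<close>

lemma ceo_achievable_dithered:
  assumes \<Delta>: "\<Delta> > 0"
  shows "ceo_achievable p s2 M (D_N0 (var_X p) s2 M + (c * real M * \<Delta> / 2)\<^sup>2)
           (\<lambda>_. 1 + ln (1 + 2 * (m / \<Delta> + 3)))"
  unfolding ceo_achievable_def
proof (intro allI impI)
  fix \<epsilon> :: real assume \<epsilon>: "\<epsilon> > 0"
  define D1 where "D1 = D_N0 (var_X p) s2 M + (c * real M * \<Delta> / 2)\<^sup>2"
  have D1: "D1 \<ge> 0"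
    unfolding D1_def D_N0_def using p_var_pos s2_pos by (intro add_nonneg_nonneg divide_nonneg_nonneg) auto
  \<comment> \<open>One more than the mean bound \<open>m / \<Delta> + 2\<close>, the margin
    required by \<open>sum_exceedance_vanishes\<close>.\<close>
  define B where "B = m / \<Delta> + 3"
  have B: "B > 0" using m_pos \<Delta> by (simp add: B_def add_pos_pos)
  \<comment> \<open>Inflating the main distortion \<open>D1\<close> by the factor
    \<open>1 + \<eta>\<close> uses half of the slack \<epsilon>; the \<open>+ 1\<close> avoids a
    zero denominator.\<close>
  define \<eta> where "\<eta> = \<epsilon> / (2 * (D1 + 1))"
  have \<eta>: "\<eta> > 0" using \<epsilon> D1 by (simp add: \<eta>_def)
  have \<eta>D: "\<eta> * D1 \<le> \<epsilon> / 2" using \<epsilon> D1 by (simp add: \<eta>_def field_simps)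
  \<comment> \<open>The penalty uses the other half: one factor \<open>real M\<close> comes from
    squaring a sum over agents, the other from adding up their contributions.\<close>
  define \<epsilon>' where "\<epsilon>' = \<epsilon> / (2 * ((1 + 1 / \<eta>) * real M * real M))"
  have M0: "real M > 0" using M_pos by simp
  have \<eta>1: "1 + 1 / \<eta> > 0" using \<eta> by (simp add: add_pos_pos)
  have \<epsilon>': "\<epsilon>' > 0" using \<epsilon> \<eta>1 M0 by (simp add: \<epsilon>'_def)
  have \<epsilon>'_eq: "(1 + 1 / \<eta>) * real M * (real M * \<epsilon>') = \<epsilon> / 2"
    using \<eta>1 M0 by (simp add: \<epsilon>'_def)
  \<comment> \<open>The dither is a fixed number known to all encoders and the decoder, so the code
    is deterministic.\<close>
  obtain u where u: "u \<in> {0..1}" and single: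
    "(\<integral>\<^sup>+s. ennreal ((fst s - recon \<Delta> u (\<lambda>i. \<lfloor>Y i s / \<Delta> + u\<rfloor>))\<^sup>2) \<partial>P) \<le> ennreal D1"
    using exists_dither_single_letter[OF \<Delta>] unfolding D1_def by blast
  define k where "k i s = \<lfloor>Y i s / \<Delta> + u\<rfloor>" for i s
  \<comment> \<open>Squared shift of the reconstruction when the integer of agent \<open>i\<close>
    is replaced by 0.\<close>
  define h where "h i s = (c * \<Delta> * real_of_int (k i s))\<^sup>2" for i s
  define bad where "bad n i = {\<omega>. (\<Sum>t<n. \<bar>real_of_int (k i (\<omega> t))\<bar>) > real n * B}" for n i
  have "\<forall>i. \<exists>n0. i < M \<longrightarrow> (\<forall>n\<ge>n0. \<forall>t<n.
     (\<integral>\<^sup>+\<omega>. ennreal (h i (\<omega> t)) * indicator (bad n i) \<omega> \<partial>Pi\<^sub>M {..<n} (\<lambda>_. P)) \<le> ennreal \<epsilon>')"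
  proof (intro allI)
    fix i
    show "\<exists>n0. i < M \<longrightarrow> (\<forall>n\<ge>n0. \<forall>t<n.
     (\<integral>\<^sup>+\<omega>. ennreal (h i (\<omega> t)) * indicator (bad n i) \<omega> \<partial>Pi\<^sub>M {..<n} (\<lambda>_. P)) \<le> ennreal \<epsilon>')"
    proof (cases "i < M")
      case True
      note q = quantised_observation[OF \<Delta> u True, folded k_def]
      have "integrable P (h i)"
        using q(2) unfolding h_def by (simp add: power_mult_distrib)
      moreover have "0 \<le> h i x" for x by (simp add: h_def)
      moreover have "(\<integral>s. \<bar>real_of_int (k i s)\<bar> \<partial>P) + 1 \<le> B" using q(3) by (simp add: B_def)
      ultimately show ?thesis
        unfolding bad_def using sum_exceedance_vanishes[OF prob_space_P q(1,2) _ _ _ \<epsilon>'] by blast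
    qed simp
  qed
  from choice[OF this] obtain n0 where n0: "\<And>i n t. i < M \<Longrightarrow> n \<ge> n0 i \<Longrightarrow> t < n \<Longrightarrow>
     (\<integral>\<^sup>+\<omega>. ennreal (h i (\<omega> t)) * indicator (bad n i) \<omega> \<partial>Pi\<^sub>M {..<n} (\<lambda>_. P)) \<le> ennreal \<epsilon>'"
    by blast
  let ?R = "1 + ln (1 + 2 * (m / \<Delta> + 3))"
  show "\<exists>N. \<forall>n\<ge>N. \<exists>(f :: nat \<Rightarrow> (nat \<Rightarrow> real) \<Rightarrow> nat) (\<phi> :: (nat \<Rightarrow> nat) \<Rightarrow> nat \<Rightarrow> real).
        (\<forall>i<M. f i \<in> measurable (\<Pi>\<^sub>M t\<in>{..<n}. borel) (count_space UNIV) \<and>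
               (\<forall>y\<in>space (\<Pi>\<^sub>M t\<in>{..<n}. (borel :: real measure)). f i y \<in> {1..n_idx n ?R})) \<and>
        avg_dist p s2 M n (\<lambda>\<omega>. \<phi> (\<lambda>i\<in>{..<M}. f i (obs n \<omega> i))) \<le> ennreal (D_N0 (var_X p) s2 M + (c * real M * \<Delta> / 2)\<^sup>2 + \<epsilon>)"
    unfolding D1_def[symmetric]
  \<comment> \<open>The sum dominates every \<open>n0 i\<close>, and the successor makes
    \<open>n\<close> positive for the normalisation by \<open>1 / n\<close>.\<close>
  proof (rule exI[of _ "Suc (\<Sum>i<M. n0 i)"], intro allI impI)
    fix n assume n: "n \<ge> Suc (\<Sum>i<M. n0 i)"
    have n0n: "n0 i \<le> n" if "i < M" for i
      using member_le_sum[of i "{..<M}" n0] that n by auto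
    define C where "C = int_codebook n B"
    have finC: "finite C" unfolding C_def by (rule int_codebook_finite)
    have zC: "(\<lambda>t\<in>{..<n}. 0) \<in> C" using B by (simp add: C_def int_codebook_def)
    \<comment> \<open>Numbers the codewords from 1 to match the index sets; the cardinality bound
      for \<open>C\<close> is exactly what the rate \<open>?R\<close> provides.\<close>
    have "card C = card {1..card C}" by simp
    then obtain b where b: "bij_betw b C {1..card C}"
      using finite_same_card_bij[OF finC] by blast
    define kk where "kk y = (let k = (\<lambda>t\<in>{..<n}. \<lfloor>y t / \<Delta> + u\<rfloor>) in if k \<in> C then k else (\<lambda>t\<in>{..<n}. 0))" for y
    have kkC: "kk y \<in> C" for y using zC by (simp add: kk_def Let_def)
    define f where "f i y = b (kk y)" for i :: nat and y
    define \<phi> where "\<phi> idx t = recon \<Delta> u (\<lambda>i. inv_into C b (idx i) t)" for idx :: "nat \<Rightarrow> nat" and t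
    have fm: "f i \<in> measurable (\<Pi>\<^sub>M t\<in>{..<n}. borel) (count_space UNIV)" for i
      unfolding f_def kk_def C_def by (rule measurable_block_quantiser[OF \<Delta>])
    have "card C \<le> n_idx n ?R"
      unfolding n_idx_ge_iff C_def using card_int_codebook_le[OF B, of n] by (simp add: B_def)
    moreover have "f i y \<in> {1..card C}" for i y
      unfolding f_def using bij_betw_apply[OF b kkC] .
    ultimately have fr: "f i y \<in> {1..n_idx n ?R}" for i y
      by (meson atLeastAtMost_iff order.trans)
    let ?Q = "Pi\<^sub>M {..<n} (\<lambda>_. P)"
    define e where "e s = fst s - recon \<Delta> u (\<lambda>i. k i s)" for s
    have dec: "(srcX n \<omega> t - \<phi> (\<lambda>i\<in>{..<M}. f i (obs n \<omega> i)) t)\<^sup>2 \<le>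
       (1 + \<eta>) * (e (\<omega> t))\<^sup>2 + (1 + 1 / \<eta>) * real M * (\<Sum>i<M. h i (\<omega> t) * indicator (bad n i) \<omega>)"
      if t: "t < n" for \<omega> t
    proof -
      \<comment> \<open>\<open>bad n i\<close> is precisely the event that the block of agent
        \<open>i\<close> leaves the codebook.\<close>
      have kko: "kk (obs n \<omega> i) t = (if \<omega> \<in> bad n i then 0 else k i (\<omega> t))" if "i < M" for i
      proof -
        have "(\<lambda>t\<in>{..<n}. \<lfloor>obs n \<omega> i t / \<Delta> + u\<rfloor>) = (\<lambda>t\<in>{..<n}. k i (\<omega> t))"
          by (auto simp: obs_def k_def Y_def fun_eq_iff)
        moreover have "(\<lambda>t\<in>{..<n}. k i (\<omega> t)) \<in> C \<longleftrightarrow> \<omega> \<notin> bad n i"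
          by (auto simp: C_def int_codebook_def bad_def)
        ultimately show ?thesis using t by (simp add: kk_def)
      qed
      have "\<phi> (\<lambda>i\<in>{..<M}. f i (obs n \<omega> i)) t = recon \<Delta> u (\<lambda>i. if \<omega> \<in> bad n i then 0 else k i (\<omega> t))"
        unfolding \<phi>_def recon_def f_def
        using bij_betw_inv_into_left[OF b kkC] by (auto simp: kko intro!: sum.cong)
      also have "\<dots> = recon \<Delta> u (\<lambda>i. k i (\<omega> t)) - (\<Sum>i<M. c * \<Delta> * real_of_int (k i (\<omega> t)) * indicator (bad n i) \<omega>)"
        unfolding recon_def sum_distrib_left add_diff_eq[symmetric] sum_subtractf[symmetric]
        by (intro arg_cong2[where f = "(+)"] refl sum.cong) (auto simp: algebra_simps)
      finally have "srcX n \<omega> t - \<phi> (\<lambda>i\<in>{..<M}. f i (obs n \<omega> i)) t =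
         e (\<omega> t) + (\<Sum>i<M. c * \<Delta> * real_of_int (k i (\<omega> t)) * indicator (bad n i) \<omega>)"
        using t by (simp add: srcX_def e_def)
      then have "(srcX n \<omega> t - \<phi> (\<lambda>i\<in>{..<M}. f i (obs n \<omega> i)) t)\<^sup>2 \<le> (1 + \<eta>) * (e (\<omega> t))\<^sup>2 +
         (1 + 1 / \<eta>) * (\<Sum>i<M. c * \<Delta> * real_of_int (k i (\<omega> t)) * indicator (bad n i) \<omega>)\<^sup>2"
        using square_add_le_weighted[OF \<eta>] by simp
      \<comment> \<open>Cauchy-Schwarz over the agents decouples their atypical events, about whose
        dependence nothing need be known.\<close>
      also have "\<dots> \<le> (1 + \<eta>) * (e (\<omega> t))\<^sup>2 + (1 + 1 / \<eta>) *
         ((\<Sum>i<M. (c * \<Delta> * real_of_int (k i (\<omega> t)) * indicator (bad n i) \<omega>)\<^sup>2) * real (card {..<M}))"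
        using \<eta>1 by (intro add_left_mono mult_left_mono sum_squared_le_sum_of_squares) auto
      also have "(\<Sum>i<M. (c * \<Delta> * real_of_int (k i (\<omega> t)) * indicator (bad n i) \<omega>)\<^sup>2) =
         (\<Sum>i<M. h i (\<omega> t) * indicator (bad n i) \<omega>)"
        by (intro sum.cong refl) (auto simp: h_def indicator_def)
      finally show ?thesis by (simp only: card_lessThan mult_ac)
    qed
    have e_int: "(\<integral>\<^sup>+\<omega>. ennreal ((e (\<omega> t))\<^sup>2) \<partial>?Q) \<le> ennreal D1"
      and e_meas: "(\<lambda>\<omega>. ennreal ((e (\<omega> t))\<^sup>2)) \<in> borel_measurable ?Q" if t: "t < n" for t
    proof -
      have km: "(\<lambda>s. real_of_int (k i s)) \<in> borel_measurable P" if "i < M" for i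
      proof -
        have [measurable]: "Y i \<in> borel_measurable P" using that by simp
        show ?thesis unfolding k_def by measurable
      qed
      have em[measurable]: "e \<in> borel_measurable P"
        unfolding e_def recon_def using km
        by (intro borel_measurable_diff borel_measurable_add borel_measurable_times borel_measurable_sum) auto
      have [measurable]: "(\<lambda>\<omega>. \<omega> t) \<in> measurable ?Q P" using t by simp
      show "(\<lambda>\<omega>. ennreal ((e (\<omega> t))\<^sup>2)) \<in> borel_measurable ?Q" by measurable
      show "(\<integral>\<^sup>+\<omega>. ennreal ((e (\<omega> t))\<^sup>2) \<partial>?Q) \<le> ennreal D1"
        using nn_integral_PiM_component[OF prob_space_P, of t "{..<n}" "\<lambda>s. ennreal ((e s)\<^sup>2)"] t em
          single[folded k_def, folded e_def] by simp
    qed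
    have hb_meas: "(\<lambda>\<omega>. ennreal (h i (\<omega> t)) * indicator (bad n i) \<omega>) \<in> borel_measurable ?Q"
      if "t < n" "i < M" for t i
    proof -
      have kQ: "(\<lambda>\<omega>. real_of_int (k i (\<omega> t))) \<in> borel_measurable ?Q" if "t < n" for t
      proof -
        have [measurable]: "Y i \<in> borel_measurable P" using \<open>i < M\<close> by simp
        have [measurable]: "(\<lambda>\<omega>. \<omega> t) \<in> measurable ?Q P" using that by simp
        show ?thesis unfolding k_def by measurable
      qed
      have [measurable]: "(\<lambda>\<omega>. \<Sum>t<n. \<bar>real_of_int (k i (\<omega> t))\<bar>) \<in> borel_measurable ?Q"
        using kQ by (intro borel_measurable_sum borel_measurable_abs) auto
      have [measurable]: "indicator (bad n i) \<in> borel_measurable ?Q"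
        unfolding bad_def by (intro borel_measurable_indicator') (simp add: pred_def[symmetric])
      note [measurable] = kQ[OF \<open>t < n\<close>]
      show ?thesis unfolding h_def by measurable
    qed
    have letter: "(\<integral>\<^sup>+\<omega>. ennreal ((srcX n \<omega> t - \<phi> (\<lambda>i\<in>{..<M}. f i (obs n \<omega> i)) t)\<^sup>2) \<partial>?Q) \<le> ennreal (D1 + \<epsilon>)"
      if t: "t < n" for t
    proof -
      have "(\<integral>\<^sup>+\<omega>. ennreal ((srcX n \<omega> t - \<phi> (\<lambda>i\<in>{..<M}. f i (obs n \<omega> i)) t)\<^sup>2) \<partial>?Q) \<le>
        (\<integral>\<^sup>+\<omega>. ennreal (1 + \<eta>) * ennreal ((e (\<omega> t))\<^sup>2) +
          ennreal ((1 + 1 / \<eta>) * real M) * (\<Sum>i<M. ennreal (h i (\<omega> t)) * indicator (bad n i) \<omega>) \<partial>?Q)"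
      proof (rule nn_integral_mono)
        fix \<omega>
        have hp: "h i s \<ge> 0" for i s by (simp add: h_def)
        have "ennreal ((srcX n \<omega> t - \<phi> (\<lambda>i\<in>{..<M}. f i (obs n \<omega> i)) t)\<^sup>2) \<le> ennreal
          ((1 + \<eta>) * (e (\<omega> t))\<^sup>2 + (1 + 1 / \<eta>) * real M * (\<Sum>i<M. h i (\<omega> t) * indicator (bad n i) \<omega>))"
          using dec[OF t] by (rule ennreal_leI)
        also have "\<dots> = ennreal ((1 + \<eta>) * (e (\<omega> t))\<^sup>2) + ennreal ((1 + 1 / \<eta>) * real M * (\<Sum>i<M. h i (\<omega> t) * indicator (bad n i) \<omega>))"
          using \<eta> \<eta>1 hp by (intro ennreal_plus mult_nonneg_nonneg sum_nonneg) auto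
        also have "ennreal ((1 + \<eta>) * (e (\<omega> t))\<^sup>2) = ennreal (1 + \<eta>) * ennreal ((e (\<omega> t))\<^sup>2)"
          using \<eta> by (intro ennreal_mult) auto
        also have "ennreal ((1 + 1 / \<eta>) * real M * (\<Sum>i<M. h i (\<omega> t) * indicator (bad n i) \<omega>)) =
           ennreal ((1 + 1 / \<eta>) * real M) * ennreal (\<Sum>i<M. h i (\<omega> t) * indicator (bad n i) \<omega>)"
          using \<eta>1 hp by (intro ennreal_mult mult_nonneg_nonneg sum_nonneg) auto
        also have "ennreal (\<Sum>i<M. h i (\<omega> t) * indicator (bad n i) \<omega>) = (\<Sum>i<M. ennreal (h i (\<omega> t)) * indicator (bad n i) \<omega>)"
          using hp by (subst sum_ennreal[symmetric]) (auto intro!: sum.cong simp: indicator_def)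
        finally show "ennreal ((srcX n \<omega> t - \<phi> (\<lambda>i\<in>{..<M}. f i (obs n \<omega> i)) t)\<^sup>2) \<le>
          ennreal (1 + \<eta>) * ennreal ((e (\<omega> t))\<^sup>2) +
          ennreal ((1 + 1 / \<eta>) * real M) * (\<Sum>i<M. ennreal (h i (\<omega> t)) * indicator (bad n i) \<omega>)" .
      qed
      also have "\<dots> = ennreal (1 + \<eta>) * (\<integral>\<^sup>+\<omega>. ennreal ((e (\<omega> t))\<^sup>2) \<partial>?Q) +
          ennreal ((1 + 1 / \<eta>) * real M) * (\<Sum>i<M. \<integral>\<^sup>+\<omega>. ennreal (h i (\<omega> t)) * indicator (bad n i) \<omega> \<partial>?Q)"
      proof -
        have s: "(\<lambda>\<omega>. \<Sum>i<M. ennreal (h i (\<omega> t)) * indicator (bad n i) \<omega>) \<in> borel_measurable ?Q"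
          using hb_meas[OF t] by (intro borel_measurable_sum) auto
        have "(\<integral>\<^sup>+\<omega>. (\<Sum>i<M. ennreal (h i (\<omega> t)) * indicator (bad n i) \<omega>) \<partial>?Q) =
           (\<Sum>i<M. \<integral>\<^sup>+\<omega>. ennreal (h i (\<omega> t)) * indicator (bad n i) \<omega> \<partial>?Q)"
          using hb_meas[OF t] by (intro nn_integral_sum) auto
        then show ?thesis
          using s e_meas[OF t] by (subst nn_integral_add) (auto simp: nn_integral_cmult)
      qed
      also have "\<dots> \<le> ennreal (1 + \<eta>) * ennreal D1 + ennreal ((1 + 1 / \<eta>) * real M) * (\<Sum>i<M. ennreal \<epsilon>')"
        using e_int[OF t] n0[OF _ n0n t] by (intro add_mono mult_left_mono sum_mono) auto
      also have "(\<Sum>i<M. ennreal \<epsilon>') = ennreal (real M * \<epsilon>')"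
        using \<epsilon>' by (subst sum_ennreal) auto
      also have "ennreal (1 + \<eta>) * ennreal D1 = ennreal ((1 + \<eta>) * D1)"
        using \<eta> D1 by (intro ennreal_mult[symmetric]) auto
      also have "ennreal ((1 + 1 / \<eta>) * real M) * ennreal (real M * \<epsilon>') =
         ennreal ((1 + 1 / \<eta>) * real M * (real M * \<epsilon>'))"
        using \<eta>1 \<epsilon>' by (intro ennreal_mult[symmetric]) auto
      also have "ennreal ((1 + \<eta>) * D1) + ennreal ((1 + 1 / \<eta>) * real M * (real M * \<epsilon>')) =
         ennreal ((1 + \<eta>) * D1 + (1 + 1 / \<eta>) * real M * (real M * \<epsilon>'))"
        using \<eta> \<eta>1 D1 \<epsilon>' by (intro ennreal_plus[symmetric]) auto
      also have "\<dots> \<le> ennreal (D1 + \<epsilon>)"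
        unfolding \<epsilon>'_eq using \<eta>D by (intro ennreal_leI) (simp add: distrib_right)
      finally show ?thesis .
    qed
    have "avg_dist p s2 M n (\<lambda>\<omega>. \<phi> (\<lambda>i\<in>{..<M}. f i (obs n \<omega> i))) \<le>
        ennreal (1 / real n) * (\<Sum>t<n. ennreal (D1 + \<epsilon>))"
      unfolding avg_dist_def block_meas_def using letter by (intro mult_left_mono sum_mono) auto
    also have "(\<Sum>t<n. ennreal (D1 + \<epsilon>)) = ennreal (real n * (D1 + \<epsilon>))"
      using D1 \<epsilon> by (subst sum_ennreal) auto
    also have "ennreal (1 / real n) * ennreal (real n * (D1 + \<epsilon>)) = ennreal (D1 + \<epsilon>)"
      using D1 \<epsilon> n by (subst ennreal_mult[symmetric]) auto
    finally have "avg_dist p s2 M n (\<lambda>\<omega>. \<phi> (\<lambda>i\<in>{..<M}. f i (obs n \<omega> i))) \<le> ennreal (D1 + \<epsilon>)" .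
    then show "\<exists>(f :: nat \<Rightarrow> (nat \<Rightarrow> real) \<Rightarrow> nat) (\<phi> :: (nat \<Rightarrow> nat) \<Rightarrow> nat \<Rightarrow> real).
        (\<forall>i<M. f i \<in> measurable (\<Pi>\<^sub>M t\<in>{..<n}. borel) (count_space UNIV) \<and>
               (\<forall>y\<in>space (\<Pi>\<^sub>M t\<in>{..<n}. (borel :: real measure)). f i y \<in> {1..n_idx n ?R})) \<and>
        avg_dist p s2 M n (\<lambda>\<omega>. \<phi> (\<lambda>i\<in>{..<M}. f i (obs n \<omega> i))) \<le> ennreal (D1 + \<epsilon>)"
      by (intro exI[of _ f] exI[of _ \<phi>] conjI allI impI ballI fm fr)
  qed
qed

end

section \<open>From achievability to the rate loss\<close>

lemma ceo_achievable_imp_rate_nonneg: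
  assumes "ceo_achievable p s2 M D R" "i < M"
  shows "R i \<ge> 0"
proof -
  obtain N where N: "\<forall>n\<ge>N. \<exists>(f :: nat \<Rightarrow> (nat \<Rightarrow> real) \<Rightarrow> nat).
     \<forall>i<M. \<forall>y\<in>space (\<Pi>\<^sub>M t\<in>{..<n}. (borel :: real measure)). f i y \<in> {1..n_idx n (R i)}"
    using assms(1) unfolding ceo_achievable_def by (meson zero_less_one)
  \<comment> \<open>Any encoder needs a nonempty index set, so \<open>exp (n * R i) \<ge> 1\<close>.
    The positive block length \<open>Suc N\<close> then gives the sign of the rate.\<close>
  from N[THEN spec, of "Suc N"] obtain f :: "nat \<Rightarrow> (nat \<Rightarrow> real) \<Rightarrow> nat" where
    "\<forall>i<M. \<forall>y\<in>space (\<Pi>\<^sub>M t\<in>{..<Suc N}. (borel :: real measure)). f i y \<in> {1..n_idx (Suc N) (R i)}"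
    by auto
  then have "f i (restrict (\<lambda>_. 0) {..<Suc N}) \<in> {1..n_idx (Suc N) (R i)}"
    by (rule allE[of _ i]) (use assms(2) restrict_in_space_PiM_borel[of "\<lambda>_. 0" "{..<Suc N}"] in auto)
  then have "1 \<le> n_idx (Suc N) (R i)" by auto
  then show ?thesis unfolding n_idx_ge_iff by (simp add: zero_le_mult_iff)
qed

lemma central_achievable_imp_rate_nonneg:
  assumes "central_achievable p s2 M D R"
  shows "R \<ge> 0"
proof -
  obtain N where N: "\<forall>n\<ge>N. \<exists>(f :: (nat \<Rightarrow> nat \<Rightarrow> real) \<Rightarrow> nat).
     \<forall>y\<in>space (\<Pi>\<^sub>M i\<in>{..<M}. \<Pi>\<^sub>M t\<in>{..<n}. (borel :: real measure)). f y \<in> {1..n_idx n R}"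
    using assms(1) unfolding central_achievable_def by (meson zero_less_one)
  from N[THEN spec, of "Suc N"] obtain f :: "(nat \<Rightarrow> nat \<Rightarrow> real) \<Rightarrow> nat" where
    f: "\<forall>y\<in>space (\<Pi>\<^sub>M i\<in>{..<M}. \<Pi>\<^sub>M t\<in>{..<Suc N}. (borel :: real measure)). f y \<in> {1..n_idx (Suc N) R}"
    by auto
  have "(\<lambda>i\<in>{..<M}. restrict (\<lambda>_. 0) {..<Suc N}) \<in> space (\<Pi>\<^sub>M i\<in>{..<M}. \<Pi>\<^sub>M t\<in>{..<Suc N}. (borel :: real measure))"
    by (auto simp: space_PiM)
  with f have "1 \<le> n_idx (Suc N) R" by fastforce
  then show ?thesis unfolding n_idx_ge_iff by (simp add: zero_le_mult_iff)
qed

text \<open>An encoder seeing all observations can compute the whole tuple of indices and send its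
  number; the index sets multiply, so the rates add. The purpose is to make the set of central rates
  nonempty.\<close>

lemma ceo_achievable_imp_central_achievable:
  assumes "ceo_achievable p s2 M D R"
  shows "central_achievable p s2 M D (\<Sum>i<M. R i)"
  unfolding central_achievable_def
proof (intro allI impI)
  fix \<epsilon> :: real assume "\<epsilon> > 0"
  then obtain N where N: "\<forall>n\<ge>N. \<exists>(f :: nat \<Rightarrow> (nat \<Rightarrow> real) \<Rightarrow> nat) (\<phi> :: (nat \<Rightarrow> nat) \<Rightarrow> nat \<Rightarrow> real).
        (\<forall>i<M. f i \<in> measurable (\<Pi>\<^sub>M t\<in>{..<n}. borel) (count_space UNIV) \<and>
               (\<forall>y\<in>space (\<Pi>\<^sub>M t\<in>{..<n}. (borel :: real measure)). f i y \<in> {1..n_idx n (R i)})) \<and>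
        avg_dist p s2 M n (\<lambda>\<omega>. \<phi> (\<lambda>i\<in>{..<M}. f i (obs n \<omega> i))) \<le> ennreal (D + \<epsilon>)"
    using assms unfolding ceo_achievable_def by blast
  show "\<exists>N. \<forall>n\<ge>N. \<exists>(f :: (nat \<Rightarrow> nat \<Rightarrow> real) \<Rightarrow> nat) (\<phi> :: nat \<Rightarrow> nat \<Rightarrow> real).
        f \<in> measurable (\<Pi>\<^sub>M i\<in>{..<M}. \<Pi>\<^sub>M t\<in>{..<n}. borel) (count_space UNIV) \<and>
        (\<forall>y\<in>space (\<Pi>\<^sub>M i\<in>{..<M}. \<Pi>\<^sub>M t\<in>{..<n}. (borel :: real measure)). f y \<in> {1..n_idx n (\<Sum>i<M. R i)}) \<and>
        avg_dist p s2 M n (\<lambda>\<omega>. \<phi> (f (\<lambda>i\<in>{..<M}. obs n \<omega> i))) \<le> ennreal (D + \<epsilon>)"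
  proof (rule exI[of _ N], intro allI impI)
    fix n assume "n \<ge> N"
    with N obtain f :: "nat \<Rightarrow> (nat \<Rightarrow> real) \<Rightarrow> nat" and \<phi> :: "(nat \<Rightarrow> nat) \<Rightarrow> nat \<Rightarrow> real" where
      fm: "\<And>i. i < M \<Longrightarrow> f i \<in> measurable (\<Pi>\<^sub>M t\<in>{..<n}. borel) (count_space UNIV)"
      and fr: "\<And>i y. i < M \<Longrightarrow> y \<in> space (\<Pi>\<^sub>M t\<in>{..<n}. (borel :: real measure)) \<Longrightarrow> f i y \<in> {1..n_idx n (R i)}"
      and dist: "avg_dist p s2 M n (\<lambda>\<omega>. \<phi> (\<lambda>i\<in>{..<M}. f i (obs n \<omega> i))) \<le> ennreal (D + \<epsilon>)"
      by blast
    define C where "C = (\<Pi>\<^sub>E i\<in>{..<M}. {1..n_idx n (R i)})"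
    have finC: "finite C" unfolding C_def by (intro finite_PiE) auto
    have "real (card C) = (\<Prod>i<M. real (n_idx n (R i)))" by (simp add: C_def card_PiE)
    also have "\<dots> \<le> (\<Prod>i<M. exp (real n * R i))"
      using n_idx_ge_iff by (intro prod_mono) auto
    also have "\<dots> = exp (real n * (\<Sum>i<M. R i))" by (simp add: exp_sum sum_distrib_left)
    finally have cardC: "card C \<le> n_idx n (\<Sum>i<M. R i)" by (simp add: n_idx_ge_iff)
    have "card C = card {1..card C}" by simp
    then obtain b where b: "bij_betw b C {1..card C}"
      using finite_same_card_bij[OF finC] by blast
    let ?S = "\<Pi>\<^sub>M i\<in>{..<M}. \<Pi>\<^sub>M t\<in>{..<n}. (borel :: real measure)"
    let ?g = "\<lambda>y. \<lambda>i\<in>{..<M}. f i (y i)"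
    have gC: "?g y \<in> C" if "y \<in> space ?S" for y
      using that fr unfolding C_def space_PiM[of "{..<M}"]
      by (intro restrict_PiE_iff[THEN iffD2] ballI) (auto dest: PiE_mem)
    have eq: "{y \<in> space ?S. ?g y = k} \<in> sets ?S" if k: "k \<in> C" for k
    proof -
      have "{y \<in> space ?S. ?g y = k} = {y \<in> space ?S. \<forall>i\<in>{..<M}. f i (y i) = k i}"
        using k by (auto simp: C_def PiE_iff fun_eq_iff extensional_def restrict_def)
      also have "\<dots> \<in> sets ?S"
      proof (rule sets.sets_Collect_finite_All)
        fix i assume i: "i \<in> {..<M}"
        have [measurable]: "(\<lambda>y. f i (y i)) \<in> measurable ?S (count_space UNIV)"
          using i by (intro measurable_compose[OF measurable_component_singleton[of i] fm[of i]]) auto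
        show "{y \<in> space ?S. f i (y i) = k i} \<in> sets ?S" by measurable
      qed simp
      finally show ?thesis .
    qed
    have "(b \<circ> ?g) -` {a} \<inter> space ?S \<in> sets ?S" for a
    proof -
      have "(b \<circ> ?g) -` {a} \<inter> space ?S = (\<Union>k\<in>{k\<in>C. b k = a}. {y \<in> space ?S. ?g y = k})"
        using gC by auto
      also have "\<dots> \<in> sets ?S" using eq finC by (intro sets.finite_UN) auto
      finally show ?thesis .
    qed
    then have meas: "b \<circ> ?g \<in> measurable ?S (count_space UNIV)"
      by (subst measurable_count_space_eq2_countable) auto
    have range: "\<forall>y\<in>space ?S. (b \<circ> ?g) y \<in> {1..n_idx n (\<Sum>i<M. R i)}"
      using bij_betw_apply[OF b gC] cardC by fastforce
    have "(\<phi> \<circ> inv_into C b) ((b \<circ> ?g) (\<lambda>i\<in>{..<M}. obs n \<omega> i)) = \<phi> (\<lambda>i\<in>{..<M}. f i (obs n \<omega> i))" for \<omega>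
    proof -
      have "(\<lambda>i\<in>{..<M}. obs n \<omega> i) \<in> space ?S" by (auto simp: space_PiM obs_def)
      then have "inv_into C b (b (?g (\<lambda>i\<in>{..<M}. obs n \<omega> i))) = ?g (\<lambda>i\<in>{..<M}. obs n \<omega> i)"
        by (intro bij_betw_inv_into_left[OF b] gC)
      moreover have "?g (\<lambda>i\<in>{..<M}. obs n \<omega> i) = (\<lambda>i\<in>{..<M}. f i (obs n \<omega> i))" by auto
      ultimately show ?thesis by simp
    qed
    then have "avg_dist p s2 M n (\<lambda>\<omega>. (\<phi> \<circ> inv_into C b) ((b \<circ> ?g) (\<lambda>i\<in>{..<M}. obs n \<omega> i))) \<le> ennreal (D + \<epsilon>)"
      using dist by simp
    then show "\<exists>(f :: (nat \<Rightarrow> nat \<Rightarrow> real) \<Rightarrow> nat) (\<phi> :: nat \<Rightarrow> nat \<Rightarrow> real).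
        f \<in> measurable ?S (count_space UNIV) \<and>
        (\<forall>y\<in>space ?S. f y \<in> {1..n_idx n (\<Sum>i<M. R i)}) \<and>
        avg_dist p s2 M n (\<lambda>\<omega>. \<phi> (f (\<lambda>i\<in>{..<M}. obs n \<omega> i))) \<le> ennreal (D + \<epsilon>)"
      by (intro exI[of _ "b \<circ> ?g"] exI[of _ "\<phi> \<circ> inv_into C b"] conjI meas range)
  qed
qed

text \<open>Real infima require care: nonnegative rates bound the CEO set below, and nonemptiness of
  the central set is what turns nonnegative elements into a nonnegative infimum.\<close>

lemma rate_loss_le_ceo_sum_rate:
  assumes "ceo_achievable p s2 M D R"
  shows "rate_loss p s2 M D \<le> (\<Sum>i<M. R i)"
proof -
  have "R_CEO p s2 M D \<le> (\<Sum>i<M. R i)"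
    unfolding R_CEO_def
  proof (rule cInf_lower)
    show "bdd_below {(\<Sum>i<M. R i) | R. ceo_achievable p s2 M D R}"
      using ceo_achievable_imp_rate_nonneg by (intro bdd_belowI[of _ 0]) (auto intro!: sum_nonneg)
  qed (use assms in blast)
  moreover have "R_R p s2 M D \<ge> 0"
    unfolding R_R_def
    using ceo_achievable_imp_central_achievable[OF assms] central_achievable_imp_rate_nonneg
    by (intro cInf_greatest) auto
  ultimately show ?thesis by (simp add: rate_loss_def)
qed

theorem theorem5:
  fixes p :: "real \<Rightarrow> real" and sW2 :: real and M :: nat
  assumes M2: "M \<ge> 2"
    and sW2_pos: "sW2 > 0"
    and p_meas: "p \<in> borel_measurable lborel"
    and p_nonneg: "\<And>x. p x \<ge> 0"
    and p_prob: "(\<integral>\<^sup>+ x. ennreal (p x) \<partial>lborel) = 1"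
    and p_var_fin: "integrable lborel (\<lambda>x. x\<^sup>2 * p x)"
    and p_var_pos: "var_X p > 0"
    and p_ent_fin: "integrable lborel (\<lambda>x. p x * ln (p x))"
  shows "\<exists>g :: real \<Rightarrow> real.
           (\<exists>\<delta>0>0. \<forall>\<delta>. 0 < \<delta> \<and> \<delta> < \<delta>0 \<longrightarrow>
               rate_loss p sW2 M (D_N0 (var_X p) sW2 M + \<delta>) \<le> g \<delta>) \<and>
           ((\<lambda>\<delta>. g \<delta> / (real M / 2 * ln (1 / \<delta>))) \<longlongrightarrow> 1) (at_right 0)"
proof -
  interpret ceo_source p sW2 M
    using assms by unfold_locales auto
  define K where "K = m * c * real M"
  have M0: "real M > 0" using M2 by simp
  have K: "K > 0" unfolding K_def using m_pos c_pos M0 by simp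
  \<comment> \<open>\<open>real M\<close> times the rate per agent
    \<open>1 + ln (1 + 2 * (m / \<Delta> + 3))\<close>, rewritten in terms of \<delta>.\<close>
  define g where "g \<delta> = real M * (1 + ln (7 + K / sqrt \<delta>))" for \<delta>
  have "rate_loss p sW2 M (D_N0 (var_X p) sW2 M + \<delta>) \<le> g \<delta>" if \<delta>: "\<delta> > 0" for \<delta>
  proof -
    \<comment> \<open>The step for which the quantisation cost
      \<open>(c * real M * \<Delta> / 2)\<^sup>2\<close> is exactly \<delta>.\<close>
    define \<Delta> where "\<Delta> = 2 * sqrt \<delta> / (c * real M)"
    have \<Delta>: "\<Delta> > 0" using \<delta> c_pos M0 by (simp add: \<Delta>_def)
    have "(c * real M * \<Delta> / 2)\<^sup>2 = \<delta>" using \<delta> c_pos M0 by (simp add: \<Delta>_def)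
    moreover have "1 + 2 * (m / \<Delta> + 3) = 7 + K / sqrt \<delta>"
      using \<delta> c_pos M0 by (simp add: \<Delta>_def K_def field_simps)
    ultimately have "ceo_achievable p sW2 M (D_N0 (var_X p) sW2 M + \<delta>) (\<lambda>_. 1 + ln (7 + K / sqrt \<delta>))"
      using ceo_achievable_dithered[OF \<Delta>] by simp
    from rate_loss_le_ceo_sum_rate[OF this] show ?thesis by (simp add: g_def)
  qed
  \<comment> \<open>The square root yields the factor 1/2: \<open>ln (7 + K / sqrt \<delta>)\<close>
    is \<open>ln (1 / \<delta>) / 2\<close> up to a bounded term.\<close>
  moreover have "((\<lambda>\<delta>. g \<delta> / (real M / 2 * ln (1 / \<delta>))) \<longlongrightarrow> 1) (at_right 0)"
    unfolding g_def using K M0 by real_asymp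
  ultimately show ?thesis by (intro exI[of _ g] conjI exI[of _ 1]) auto
qed

end
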